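(* Let $V$ be a rank one valuation domain with quotient field $K$ such that the set $\mathcal{W}$ of Ostrowski valuation domains is nonempty. Then $\mathcal{V}=\{V_E\mid E\subset K\text{ is a pseudo-convergent sequence}\}$, endowed with the Zariski topology, is a regular topological space.
   Context: Let $v$ be the valuation of $V$, with value group regarded as a subgroup of $\mathbb{R}$. A sequence $E=\{s_n\}_{n\in\mathbb{N}}$ in $K$ is pseudo-convergent if $v(s_{n+1}-s_n)<v(s_{n+2}-s_{n+1})$ for all $n$. Let $V_E=\{\phi\in K(X)\mid \phi(s_n)\in V\text{ for all but finitely many }n\in\mathbb{N}\}$, a valuation domain of $K(X)$ lying over $V$. For $\phi\in K(X)$ let $w_E(\phi)=\lim_{n\to\infty}v(\phi(s_n))$; when $w_E$ is a valuation on $K(X)$, $W_E=\{\phi\in K(X)\mid w_E(\phi)\geq 0\}$ is its valuation domain, and $\mathcal{W}$ is the set of all such $W_E$. The Zariski topology on $\mathcal{V}$ is the one generated by the subbasic open sets $\{V_E\in\mathcal{V}\mid \phi\in V_E\}$, for $\phi\in K(X)$. A topological space is regular if every point is closed and, whenever $C$ is a closed set and $x\notin C$, there are disjoint open sets $\Omega_1\ni x$ and $\Omega_2\supseteq C$. *)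

theory Defs
  imports
    "HOL-Analysis.Analysis"
    "HOL-Algebra.Ideal"
    "HOL-Computational_Algebra.Fraction_Field"
    "HOL-Computational_Algebra.Polynomial"
begin

text \<open>The ambient field K is a type of class \<open>field\<close>; a subring V of K is a subset.\<close>

definition restricted_ring :: "'a::field set \<Rightarrow> 'a ring" where
  "restricted_ring V = \<lparr>carrier = V, mult = (*), one = 1, zero = 0, add = (+)\<rparr>"

definition valuation_domain :: "'a::field set \<Rightarrow> bool" where
  "valuation_domain V \<longleftrightarrow>
     domain (restricted_ring V) \<and> (\<forall>x. x \<noteq> 0 \<longrightarrow> x \<in> V \<or> inverse x \<in> V)"

text \<open>
  The second condition above makes K the quotient field of V. As the ideals of a valuation
  domain are totally ordered, Krull dimension one means that there is exactly one nonzero prime.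
\<close>

definition rank_one_valuation_domain :: "'a::field set \<Rightarrow> bool" where
  "rank_one_valuation_domain V \<longleftrightarrow>
     valuation_domain V \<and> (\<exists>!P. primeideal P (restricted_ring V) \<and> P \<noteq> {0})"

text \<open>Valuations with value group a subgroup of the reals.\<close>

definition real_valuation :: "('a::field \<Rightarrow> ereal) \<Rightarrow> bool" where
  "real_valuation v \<longleftrightarrow>
     v 0 = \<infinity> \<and> (\<forall>x. x \<noteq> 0 \<longrightarrow> \<bar>v x\<bar> \<noteq> \<infinity>) \<and>
     (\<forall>x y. v (x * y) = v x + v y) \<and>
     (\<forall>x y. min (v x) (v y) \<le> v (x + y))"

definition valuation_ring :: "('a::field \<Rightarrow> ereal) \<Rightarrow> 'a set" where
  "valuation_ring v = {x. 0 \<le> v x}"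

definition pseudo_convergent :: "('a::field \<Rightarrow> ereal) \<Rightarrow> (nat \<Rightarrow> 'a) \<Rightarrow> bool" where
  "pseudo_convergent v s \<longleftrightarrow>
     (\<forall>n. v (s (n + 1) - s n) < v (s (n + 2) - s (n + 1)))"

text \<open>
  K(X) is \<open>'a poly fract\<close>. The value of a rational function at a point is computed from any
  representation whose denominator does not vanish there; at a pole it is an unspecified element.
  Below only the values \<open>\<phi>(s\<^sub>n)\<close> for large n matter, and these are never taken at a pole because
  the terms of a pseudo-convergent sequence are pairwise distinct.
\<close>

definition eval_ratfun :: "'a::field poly fract \<Rightarrow> 'a \<Rightarrow> 'a" where
  "eval_ratfun \<phi> a =
     (THE y. \<exists>p q. \<phi> = Fraction_Field.Fract p q \<and> poly q a \<noteq> 0 \<and> y = poly p a / poly q a)"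

lemma eval_ratfun_Fract:
  assumes "poly q a \<noteq> 0"
  shows "eval_ratfun (Fraction_Field.Fract p q) a = poly p a / poly q a"
  unfolding eval_ratfun_def
proof (rule the_equality)
  fix y
  assume "\<exists>p' q'. Fraction_Field.Fract p q = Fraction_Field.Fract p' q' \<and> poly q' a \<noteq> 0 \<and>
    y = poly p' a / poly q' a"
  then obtain p' q' where *: "Fraction_Field.Fract p q = Fraction_Field.Fract p' q'"
    "poly q' a \<noteq> 0" "y = poly p' a / poly q' a"
    by blast
  have "q \<noteq> 0" "q' \<noteq> 0"
    using assms *(2) by auto
  then have "p * q' = p' * q"
    using *(1) by (simp add: eq_fract)
  then have "poly p a * poly q' a = poly p' a * poly q a"
    by (simp flip: poly_mult)
  then show "y = poly p a / poly q a"
    using assms *(2,3) by (simp add: frac_eq_eq)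
qed (rule exI[of _ p], rule exI[of _ q], intro conjI refl assms)

definition V_dom :: "'a::field set \<Rightarrow> (nat \<Rightarrow> 'a) \<Rightarrow> 'a poly fract set" where
  "V_dom V s = {\<phi>. \<forall>\<^sub>F n in sequentially. eval_ratfun \<phi> (s n) \<in> V}"

definition V_space :: "'a::field set \<Rightarrow> ('a \<Rightarrow> ereal) \<Rightarrow> 'a poly fract set set" where
  "V_space V v = {V_dom V s | s. pseudo_convergent v s}"

definition w_val :: "('a::field \<Rightarrow> ereal) \<Rightarrow> (nat \<Rightarrow> 'a) \<Rightarrow> 'a poly fract \<Rightarrow> ereal" where
  "w_val v s \<phi> = lim (\<lambda>n. v (eval_ratfun \<phi> (s n)))"

text \<open>
  Convergence in the extended reals is demanded explicitly below because \<open>lim\<close> is unspecified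
  for divergent sequences.
\<close>

definition W_space :: "('a::field \<Rightarrow> ereal) \<Rightarrow> 'a poly fract set set" where
  "W_space v =
     {valuation_ring (w_val v s) | s.
        pseudo_convergent v s \<and>
        (\<forall>\<phi>. convergent (\<lambda>n. v (eval_ratfun \<phi> (s n)))) \<and>
        real_valuation (w_val v s)}"

definition zariski_topology :: "'b set set \<Rightarrow> 'b set topology" where
  "zariski_topology \<V> = topology_generated_by (range (\<lambda>\<phi>. {U \<in> \<V>. \<phi> \<in> U}))"

lemma topspace_zariski_topology:
  assumes "{} \<notin> \<V>"
  shows "topspace (zariski_topology \<V>) = \<V>"
proof
  show "topspace (zariski_topology \<V>) \<subseteq> \<V>"
    unfolding zariski_topology_def topology_generated_by_topspace by blast
  show "\<V> \<subseteq> topspace (zariski_topology \<V>)"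
  proof
    fix U assume "U \<in> \<V>"
    moreover obtain \<phi> where "\<phi> \<in> U"
      using assms \<open>U \<in> \<V>\<close> by (metis all_not_in_conv)
    ultimately show "U \<in> topspace (zariski_topology \<V>)"
      unfolding zariski_topology_def topology_generated_by_topspace by blast
  qed
qed

text \<open>The library's \<^const>\<open>regular_space\<close> does not require points to be closed.\<close>

definition regular_with_closed_points :: "'b topology \<Rightarrow> bool" where
  "regular_with_closed_points X \<longleftrightarrow>
     (\<forall>x\<in>topspace X. closedin X {x}) \<and> regular_space X"

end

theory Submission
  imports Defs
begin

text \<open>
  The space has a basis of clopen sets, and a T0 space with such a basis is regular and Hausdorff.
  For a polynomial f and a pseudo-convergent sequence s the values v (f (s n)) are eventually
  nondecreasing (Ostrowski, Kaplansky). Hence for every nonzero constant c the condition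
  \<open>c / f \<in> V\<^sub>E\<close> says that v (f (s n)) is eventually at most v c, and its negation says that
  v (f (s n)) eventually exceeds v c by a fixed amount, which is again an open condition.

  To shrink such clopen sets into \<open>{V\<^sub>E. g / h \<in> V\<^sub>E}\<close>, expand g and h in powers of a polynomial q
  of minimal degree whose values along s do not stabilise (if all polynomials have stable values,
  these are locally constant and there is nothing to do). The values of the coefficients are
  locally constant, so v (g x) and v (h x) are governed by finitely many affine functions of
  v (q x), and it remains to look at these near the limit \<open>\<delta>\<close> of the values v (q (s n)).
\<close>

section \<open>Arithmetic of a real-valued valuation\<close>

locale real_valued_field =
  fixes v :: "'a::field \<Rightarrow> ereal"
  assumes real_valuation: "real_valuation v"
begin

text \<open>The real-valued form admits linear arithmetic. At 0 it takes the default value 0 of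
  \<open>real_of_ereal\<close> instead of infinity, so translations between \<open>v\<close> and
  \<open>val\<close> exclude 0.\<close>

definition val :: "'a \<Rightarrow> real" where
  "val x = real_of_ereal (v x)"

lemma v_zero [simp]: "v 0 = \<infinity>"
  and v_mult: "v (x * y) = v x + v y"
  and v_add: "min (v x) (v y) \<le> v (x + y)"
  using real_valuation unfolding real_valuation_def by auto

lemma v_eq_val: "x \<noteq> 0 \<Longrightarrow> v x = ereal (val x)"
  using real_valuation unfolding real_valuation_def val_def by (simp add: ereal_real)

lemma v_eq_infinity_iff [simp]: "v x = \<infinity> \<longleftrightarrow> x = 0"
  using v_eq_val[of x] by (cases "x = 0") auto

lemma infinity_eq_v_iff [simp]: "\<infinity> = v x \<longleftrightarrow> x = 0"
  using v_eq_infinity_iff[of x] by metis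

lemma val_mult: "x \<noteq> 0 \<Longrightarrow> y \<noteq> 0 \<Longrightarrow> val (x * y) = val x + val y"
  using v_mult[of x y] v_eq_val[of x] v_eq_val[of y] v_eq_val[of "x * y"] by auto

lemma val_one [simp]: "val 1 = 0"
  using val_mult[of 1 1] by simp

lemma val_power: "x \<noteq> 0 \<Longrightarrow> val (x ^ n) = real n * val x"
  by (induction n) (simp_all add: val_mult algebra_simps)

lemma val_inverse: "x \<noteq> 0 \<Longrightarrow> val (inverse x) = - val x"
  using val_mult[of x "inverse x"] by simp

lemma val_divide: "x \<noteq> 0 \<Longrightarrow> y \<noteq> 0 \<Longrightarrow> val (x / y) = val x - val y"
  by (simp add: divide_inverse val_mult val_inverse)

lemma v_minus [simp]: "v (- x) = v x"
proof (cases "x = 0")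
  case False
  have "val (- 1) = 0"
    using val_mult[of "- 1" "- 1"] by simp
  then show ?thesis
    using False val_mult[of "- 1" x] by (simp add: v_eq_val)
qed simp

lemma v_diff_commute: "v (x - y) = v (y - x)"
  using v_minus[of "x - y"] by simp

text \<open>For the second inequality \<open>x\<close> is written as \<open>(x + y) - y\<close>:
  otherwise both parts would have a value greater than \<open>v x\<close>.\<close>

lemma v_add_eq:
  assumes "v x < v y"
  shows "v (x + y) = v x"
proof (rule antisym)
  show "v x \<le> v (x + y)"
    using v_add[of x y] assms by (auto simp: min_le_iff_disj)
  show "v (x + y) \<le> v x"
    using v_add[of "x + y" "- y"] assms by (auto simp: min_le_iff_disj)
qed

lemma v_eq_if_diff:
  assumes "v x < v (y - x)"
  shows "v y = v x"
  using v_add_eq[OF assms] by simp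

lemma v_sum_ge:
  assumes "finite S" "\<And>i. i \<in> S \<Longrightarrow> a \<le> v (t i)"
  shows "a \<le> v (sum t S)"
  using assms
proof (induction S rule: finite_induct)
  case (insert i S)
  then have "a \<le> min (v (t i)) (v (sum t S))"
    by auto
  also have "\<dots> \<le> v (t i + sum t S)"
    by (rule v_add)
  finally show ?case
    using insert.hyps by simp
qed simp

text \<open>The bound \<open>a < \<infinity>\<close> takes care of the empty sum, whose value is
  infinite.\<close>

lemma v_sum_gt:
  assumes "finite S" "a < \<infinity>" "\<And>i. i \<in> S \<Longrightarrow> a < v (t i)"
  shows "a < v (sum t S)"
  using assms(1,3)
proof (induction S rule: finite_induct)
  case empty
  then show ?case using assms(2) by simp
next
  case (insert i S)
  then have "a < min (v (t i)) (v (sum t S))"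
    by auto
  also have "\<dots> \<le> v (t i + sum t S)"
    by (rule v_add)
  finally show ?case
    using insert.hyps by simp
qed

text \<open>The terms other than \<open>t i\<close> add up to an element of larger value and cannot
  cancel \<open>t i\<close>. As \<open>t i\<close> is nonzero, this includes the case that there are
  no other terms.\<close>

lemma v_sum_eq:
  assumes "finite S" "i \<in> S" "t i \<noteq> 0" "\<And>k. k \<in> S - {i} \<Longrightarrow> v (t i) < v (t k)"
  shows "v (sum t S) = v (t i)"
proof -
  have "v (t i) < v (sum t (S - {i}))"
    using assms by (intro v_sum_gt) auto
  then show ?thesis
    using v_add_eq assms(1,2) by (simp add: sum.remove[of S i])
qed

lemma v_le_quotient_iff:
  assumes "y \<noteq> 0"
  shows "0 \<le> v (x / y) \<longleftrightarrow> v y \<le> v x"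
proof (cases "x = 0")
  case False
  then show ?thesis using assms by (simp add: v_eq_val val_divide)
qed simp

end

section \<open>Polynomial expansions and dominant affine functions\<close>

text \<open>The polynomials \<open>H i\<close> are the Hasse derivatives of \<open>p\<close>; no
  factorials occur, so the characteristic is arbitrary. The degree bound lets hypotheses on
  polynomials of smaller degree apply to the coefficients.\<close>

lemma taylor_expansion:
  fixes p :: "'a::field poly"
  assumes "degree p \<le> n"
  shows "\<exists>H. H 0 = p \<and> (\<forall>i. degree (H i) \<le> n - i) \<and> (\<forall>i>n. H i = 0) \<and>
    (\<forall>x y. poly p y = (\<Sum>i\<le>n. poly (H i) x * (y - x) ^ i))"
  using assms
proof (induction n arbitrary: p)
  case 0
  then obtain a where "p = [:a:]"
    using degree_eq_zeroE by blast
  then show ?case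
    by (intro exI[of _ "\<lambda>i. if i = 0 then p else 0"]) auto
next
  case (Suc n)
  obtain a p' where p: "p = pCons a p'"
    by (cases p)
  then have "degree p' \<le> n"
    using Suc.prems by (auto split: if_splits)
  from Suc.IH[OF this] obtain H where H: "H 0 = p'" "\<And>i. degree (H i) \<le> n - i"
    "\<And>i. i > n \<Longrightarrow> H i = 0" "\<And>x y. poly p' y = (\<Sum>i\<le>n. poly (H i) x * (y - x) ^ i)"
    by blast
  \<comment> \<open>Leibniz rule for \<open>X * p'\<close>: its Hasse derivative of order
    \<open>Suc i\<close> is \<open>X\<close> times the one of \<open>p'\<close> of the same order
    plus the one of order \<open>i\<close>.\<close>
  define G where "G = (\<lambda>i. case i of 0 \<Rightarrow> p | Suc i \<Rightarrow> pCons 0 (H (Suc i)) + H i)"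
  have "degree (G i) \<le> Suc n - i" for i
  proof (cases i)
    case 0
    then show ?thesis using Suc.prems by (simp add: G_def)
  next
    case (Suc k)
    \<comment> \<open>Prefixing 0 raises the degree only of a nonzero polynomial, and
      \<open>H (Suc k)\<close> is 0 for \<open>k \<ge> n\<close>.\<close>
    have "degree (pCons 0 (H (Suc k))) \<le> n - k"
      using H(2)[of "Suc k"] H(3)[of "Suc k"] by (cases "k < n") auto
    then show ?thesis
      using H(2)[of k] Suc by (auto simp: G_def intro!: degree_add_le)
  qed
  moreover have "poly p y = (\<Sum>i\<le>Suc n. poly (G i) x * (y - x) ^ i)" for x y
  proof -
    let ?f = "\<lambda>i. poly (H i) x * (y - x) ^ i"
    \<comment> \<open>Splitting \<open>G\<close> into its two summands gives
      \<open>p x + x * (p' y - p' x) + (y - x) * p' y\<close>, which is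
      \<open>a + y * p' y\<close>.\<close>
    have "(\<Sum>i\<le>Suc n. poly (G i) x * (y - x) ^ i) =
        poly p x + (\<Sum>i\<le>n. x * ?f (Suc i)) + (\<Sum>i\<le>n. (y - x) * ?f i)"
      by (simp add: sum.atMost_Suc_shift G_def sum.distrib[symmetric] algebra_simps
          del: sum.atMost_Suc)
    also have "(\<Sum>i\<le>n. x * ?f (Suc i)) = x * ((\<Sum>i\<le>n. ?f i) - ?f 0)"
      using sum.atMost_Suc_shift[of ?f n] H(3)[of "Suc n"]
      by (simp add: sum_distrib_left[symmetric])
    also have "(\<Sum>i\<le>n. (y - x) * ?f i) = (y - x) * (\<Sum>i\<le>n. ?f i)"
      by (simp add: sum_distrib_left)
    finally show ?thesis
      using p H(1) by (simp add: H(4)[of y x, symmetric] algebra_simps)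
  qed
  ultimately show ?case
    using H(3) by (intro exI[of _ G]) (auto simp: G_def split: nat.splits)
qed

text \<open>Repeated division by \<open>q\<close>, as for digits in a number base: the remainder is
  the lowest digit and the quotient supplies the others.\<close>

lemma adic_expansion:
  fixes p q :: "'a::field poly"
  assumes "degree q > 0"
  shows "\<exists>A m. p = (\<Sum>k\<le>m. A k * q ^ k) \<and> (\<forall>k. degree (A k) < degree q)"
proof (induction "degree p" arbitrary: p rule: less_induct)
  case less
  show ?case
  proof (cases "degree p < degree q")
    case True
    then show ?thesis
      using assms by (intro exI[of _ "\<lambda>k. if k = 0 then p else 0"] exI[of _ 0]) auto
  next
    case False
    have "q \<noteq> 0" using assms by auto
    have "degree (p div q) < degree p"
      using False assms by (simp add: degree_div_less)
    from less[OF this] obtain A m where A: "p div q = (\<Sum>k\<le>m. A k * q ^ k)"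
      "\<And>k. degree (A k) < degree q"
      by blast
    define B where "B = (\<lambda>k. case k of 0 \<Rightarrow> p mod q | Suc k \<Rightarrow> A k)"
    have "p = p mod q + p div q * q" by simp
    also have "\<dots> = (\<Sum>k\<le>Suc m. B k * q ^ k)"
      by (subst sum.atMost_Suc_shift) (simp add: B_def A(1) sum_distrib_left mult_ac)
    finally have "p = (\<Sum>k\<le>Suc m. B k * q ^ k)" .
    moreover have "degree (B k) < degree q" for k
      using A(2) degree_mod_less'[OF \<open>q \<noteq> 0\<close>, of p] assms
      by (cases "p mod q = 0") (auto simp: B_def split: nat.splits)
    ultimately show ?thesis by blast
  qed
qed

text \<open>The members of \<open>S\<close> are the slopes, so two distinct functions cross at most
  once. Along a strictly increasing sequence, bounded or not, each pair is therefore eventually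
  strictly ordered.\<close>

lemma eventually_affine_dominant:
  fixes \<gamma> :: "nat \<Rightarrow> real" and \<epsilon> :: "nat \<Rightarrow> real"
  assumes "finite S" "S \<noteq> {}" and inc: "\<forall>n\<ge>N. \<epsilon> n < \<epsilon> (Suc n)"
  shows "\<exists>i\<in>S. \<forall>\<^sub>F n in sequentially. \<forall>k\<in>S-{i}. \<gamma> i + i * \<epsilon> n < \<gamma> k + k * \<epsilon> n"
proof -
  have less: "\<epsilon> m < \<epsilon> n" if "N \<le> m" "m < n" for m n
    using that(2,1) inc by (induction rule: less_Suc_induct) (auto intro: less_trans)
  have aux: "(\<forall>\<^sub>F n in sequentially. \<gamma> i + i * \<epsilon> n < \<gamma> k + k * \<epsilon> n) \<or>
      (\<forall>\<^sub>F n in sequentially. \<gamma> k + k * \<epsilon> n < \<gamma> i + i * \<epsilon> n)" if "i < k" for i k :: nat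
  proof (cases "\<exists>n\<ge>N. \<gamma> i + i * \<epsilon> n \<le> \<gamma> k + k * \<epsilon> n")
    case True
    then obtain n where n: "n \<ge> N" "\<gamma> i + i * \<epsilon> n \<le> \<gamma> k + k * \<epsilon> n" by blast
    have "\<gamma> i + i * \<epsilon> m < \<gamma> k + k * \<epsilon> m" if "m > n" for m
    proof -
      have "(real k - real i) * \<epsilon> n < (real k - real i) * \<epsilon> m"
        using less[OF n(1) that] \<open>i < k\<close> by (intro mult_strict_left_mono) auto
      then show ?thesis using n(2) by (simp add: algebra_simps)
    qed
    then show ?thesis
      by (intro disjI1 eventually_mono[OF eventually_gt_at_top[of n]])
  next
    case False
    then show ?thesis
      by (intro disjI2 eventually_mono[OF eventually_ge_at_top[of N]]) (meson not_le)
  qed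
  show ?thesis
    using assms(1,2)
  proof (induction S rule: finite_ne_induct)
    case (singleton x)
    then show ?case by simp
  next
    case (insert x S)
    then obtain i where i: "i \<in> S"
      "\<forall>\<^sub>F n in sequentially. \<forall>k\<in>S-{i}. \<gamma> i + i * \<epsilon> n < \<gamma> k + k * \<epsilon> n"
      by blast
    have "i \<noteq> x" using i insert by auto
    then consider "\<forall>\<^sub>F n in sequentially. \<gamma> i + i * \<epsilon> n < \<gamma> x + x * \<epsilon> n"
      | "\<forall>\<^sub>F n in sequentially. \<gamma> x + x * \<epsilon> n < \<gamma> i + i * \<epsilon> n"
      using aux[of i x] aux[of x i] by (meson linorder_neqE_nat)
    then show ?case
    proof cases
      case 1
      have "\<forall>\<^sub>F n in sequentially. \<forall>k\<in>insert x S-{i}. \<gamma> i + i * \<epsilon> n < \<gamma> k + k * \<epsilon> n"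
        using i(2) 1 by eventually_elim auto
      then show ?thesis using i by blast
    next
      case 2
      have "\<forall>\<^sub>F n in sequentially. \<forall>k\<in>insert x S-{x}. \<gamma> x + x * \<epsilon> n < \<gamma> k + k * \<epsilon> n"
        using i(2) 2 by eventually_elim (auto intro: less_trans)
      then show ?thesis by blast
    qed
  qed
qed

section \<open>Values of polynomials along a pseudo-convergent sequence\<close>

context real_valued_field
begin

text \<open>The eventual value may be infinite, so the zero polynomial is stable.\<close>

definition stable :: "(nat \<Rightarrow> 'a) \<Rightarrow> 'a poly \<Rightarrow> bool" where
  "stable s p \<longleftrightarrow> (\<exists>\<gamma>. \<forall>\<^sub>F n in sequentially. v (poly p (s n)) = \<gamma>)"

context
  fixes s assumes pc: "pseudo_convergent v s"
begin

lemma step_less: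
  assumes "m < n"
  shows "v (s (Suc m) - s m) < v (s (Suc n) - s n)"
  using assms
proof (induction rule: less_Suc_induct)
  case (1 i)
  then show ?case using pc by (simp add: pseudo_convergent_def)
qed (rule less_trans)

text \<open>All steps after the first have larger value, so adding them does not change the value of
  the difference.\<close>

lemma v_diff_eq_step: "m < n \<Longrightarrow> v (s n - s m) = v (s (Suc m) - s m)"
proof (induction n)
  case (Suc n)
  show ?case
  proof (cases "m = n")
    case False
    then have IH: "v (s n - s m) = v (s (Suc m) - s m)" and "m < n"
      using Suc by auto
    then have "v (s n - s m) < v (s (Suc n) - s n)"
      using step_less by simp
    from v_add_eq[OF this] show ?thesis
      using IH by simp
  qed simp
qed simp

lemma step_nonzero: "s (Suc n) - s n \<noteq> 0"
  using step_less[of n "Suc n"] by auto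

lemma inj_pseudo_convergent: "inj s"
proof (rule linorder_injI)
  fix m n :: nat assume "m < n"
  then show "s m \<noteq> s n"
    using v_diff_eq_step[of m n] step_nonzero[of m] by auto
qed

text \<open>The terms are distinct, so each of the finitely many roots is met at most once.\<close>

lemma eventually_poly_nonzero:
  assumes "p \<noteq> 0"
  shows "\<forall>\<^sub>F n in sequentially. poly p (s n) \<noteq> 0"
proof -
  have "finite (s -` {x. poly p x = 0})"
    using inj_pseudo_convergent poly_roots_finite[OF assms] by (rule finite_vimageI[rotated])
  then show ?thesis
    by (simp add: vimage_def cofinite_eq_sequentially[symmetric] eventually_cofinite)
qed

text \<open>The eventual value is attained at a term where \<open>p\<close> does not vanish. It is
  thus the value of a field element, which can serve as a constant in rational functions.\<close>

lemma stable_value: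
  assumes "stable s p" "p \<noteq> 0"
  shows "\<exists>b. b \<noteq> 0 \<and> (\<forall>\<^sub>F n in sequentially. v (poly p (s n)) = v b)"
proof -
  obtain \<gamma> where \<gamma>: "\<forall>\<^sub>F n in sequentially. v (poly p (s n)) = \<gamma>"
    using assms(1) unfolding stable_def by blast
  obtain n where "v (poly p (s n)) = \<gamma>" "poly p (s n) \<noteq> 0"
    using eventually_happens[OF eventually_conj[OF \<gamma> eventually_poly_nonzero[OF assms(2)]]] by auto
  then show ?thesis using \<gamma> by blast
qed

text \<open>
  The values of the coefficients of the Taylor expansion of p at s n stabilise by assumption, so
  one term of it dominates and p maps s to a sequence that is pseudo-convergent from some point on.
\<close>

lemma kaplansky_dichotomy:
  assumes "\<And>p'. degree p' < degree p \<Longrightarrow> stable s p'"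
  shows "(\<exists>n \<gamma>. (\<forall>m\<ge>n. v (poly p (s m)) = \<gamma>) \<and>
      (\<forall>x. v (s (Suc n) - s n) < v (x - s (Suc n)) \<longrightarrow> v (poly p x) = \<gamma>)) \<or>
    (\<exists>N. \<forall>n\<ge>N. v (poly p (s n)) < v (poly p (s (Suc n))))"
proof -
  obtain H where H: "H 0 = p" "\<And>i. degree (H i) \<le> degree p - i"
    "\<And>x y. poly p y = (\<Sum>i\<le>degree p. poly (H i) x * (y - x) ^ i)"
    using taylor_expansion[of p "degree p"] by auto
  \<comment> \<open>Only nonzero coefficients of positive order enter the differences of
    \<open>p\<close>. Their degrees are smaller than that of \<open>p\<close>, so their values
    stabilise.\<close>
  define S where "S = {i. 1 \<le> i \<and> i \<le> degree p \<and> H i \<noteq> 0}"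
  have [simp]: "finite S" by (simp add: S_def)
  have diff: "poly p y - poly p x = (\<Sum>i\<in>S. poly (H i) x * (y - x) ^ i)" for x y
  proof -
    have "poly p y = poly p x + (\<Sum>i\<in>{..degree p} - {0}. poly (H i) x * (y - x) ^ i)"
      using H(3)[of y x] H(1) by (simp add: sum.remove[of _ 0])
    also have "(\<Sum>i\<in>{..degree p} - {0}. poly (H i) x * (y - x) ^ i) =
        (\<Sum>i\<in>S. poly (H i) x * (y - x) ^ i)"
      by (rule sum.mono_neutral_right) (auto simp: S_def)
    finally show ?thesis by simp
  qed
  have "\<exists>b. b \<noteq> 0 \<and> (\<forall>\<^sub>F n in sequentially. v (poly (H i) (s n)) = v b)" if "i \<in> S" for i
  proof (rule stable_value)
    show "stable s (H i)"
      using that H(2)[of i] by (intro assms) (auto simp: S_def)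
  qed (use that in \<open>simp add: S_def\<close>)
  then obtain b where b: "\<And>i. i \<in> S \<Longrightarrow> b i \<noteq> 0"
    "\<And>i. i \<in> S \<Longrightarrow> \<forall>\<^sub>F n in sequentially. v (poly (H i) (s n)) = v (b i)"
    by metis
  define \<delta> where "\<delta> n = val (s (Suc n) - s n)" for n
  have v_step: "v (s (Suc n) - s n) = ereal (\<delta> n)" for n
    using v_eq_val step_nonzero by (simp add: \<delta>_def)
  have \<delta>_less: "\<delta> m < \<delta> n" if "m < n" for m n
    using step_less[OF that] by (simp add: v_step)
  show ?thesis
  proof (cases "S = {}")
    case True
    then have "poly p y = poly p x" for x y
      using diff[of x y] by simp
    then show ?thesis by (metis order_refl)
  next
    case False
    obtain i where i: "i \<in> S" "\<forall>\<^sub>F n in sequentially. \<forall>k\<in>S-{i}.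
        val (b i) + i * \<delta> n < val (b k) + k * \<delta> n"
      using eventually_affine_dominant[OF \<open>finite S\<close> False,
          where \<epsilon> = \<delta> and N = 0 and \<gamma> = "\<lambda>k. val (b k)"]
        \<delta>_less by auto
    have "\<forall>\<^sub>F n in sequentially. \<forall>k\<in>S. v (poly (H k) (s n)) = v (b k)"
      using b(2) by (simp add: eventually_ball_finite)
    from eventually_conj[OF this i(2)]
    obtain N where N: "\<And>n k. n \<ge> N \<Longrightarrow> k \<in> S \<Longrightarrow> v (poly (H k) (s n)) = v (b k)"
      "\<And>n k. n \<ge> N \<Longrightarrow> k \<in> S - {i} \<Longrightarrow> val (b i) + i * \<delta> n < val (b k) + k * \<delta> n"
      unfolding eventually_sequentially by blast
    \<comment> \<open>The value of the dominant Taylor term at the \<open>n\<close>-th step; it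
      turns out to be the value of \<open>poly p (s (Suc n)) - poly p (s n)\<close>.\<close>
    define \<theta> where "\<theta> n = val (b i) + i * \<delta> n" for n
    have \<theta>_le: "\<theta> n \<le> val (b k) + k * \<delta> n" if "n \<ge> N" "k \<in> S" for n k
      using N(2)[OF that(1), of k] that(2) by (cases "k = i") (auto simp: \<theta>_def)
    have "i \<ge> 1" using i(1) by (simp add: S_def)
    then have \<theta>_less: "\<theta> n < \<theta> (Suc n)" for n
      using \<delta>_less[of n "Suc n"] by (simp add: \<theta>_def)
    have summand: "poly (H k) (s n) * (x - s n) ^ k \<noteq> 0"
      "val (poly (H k) (s n) * (x - s n) ^ k) = val (b k) + k * val (x - s n)"
      if "n \<ge> N" "k \<in> S" "x \<noteq> s n" for n k x
    proof -
      have "poly (H k) (s n) \<noteq> 0"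
        using N(1)[OF that(1,2)] b(1)[OF that(2)] v_eq_infinity_iff by metis
      moreover from this have "val (poly (H k) (s n)) = val (b k)"
        using N(1)[OF that(1,2)] b(1)[OF that(2)] by (simp add: v_eq_val)
      ultimately show "poly (H k) (s n) * (x - s n) ^ k \<noteq> 0"
        "val (poly (H k) (s n) * (x - s n) ^ k) = val (b k) + k * val (x - s n)"
        using that(3) by (simp_all add: val_mult val_power)
    qed
    \<comment> \<open>Centre and level have separate indices because the bound is needed at the
      centre \<open>s (Suc n)\<close> with level \<open>n\<close>.\<close>
    have diff_ge: "\<theta> m \<le> v (poly p x - poly p (s n))"
      if "n \<ge> N" "m \<ge> N" "ereal (\<delta> m) \<le> v (x - s n)" for n m x
    proof (cases "x = s n")
      case False
      have "\<theta> m \<le> v (poly (H k) (s n) * (x - s n) ^ k)" if "k \<in> S" for k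
      proof -
        have "\<theta> m \<le> val (b k) + k * \<delta> m"
          using \<theta>_le \<open>m \<ge> N\<close> that by simp
        also have "\<dots> \<le> val (b k) + k * val (x - s n)"
          using \<open>ereal (\<delta> m) \<le> v (x - s n)\<close> False by (simp add: v_eq_val mult_left_mono)
        finally show ?thesis
          using summand[OF \<open>n \<ge> N\<close> that False] v_eq_val by simp
      qed
      then show ?thesis
        unfolding diff[of x "s n"] by (intro v_sum_ge) auto
    qed simp
    have diff_eq: "v (poly p x - poly p (s n)) = \<theta> n"
      if "n \<ge> N" "v (x - s n) = ereal (\<delta> n)" for n x
    proof -
      have "x \<noteq> s n" using that(2) by auto
      have \<delta>: "val (x - s n) = \<delta> n" using that(2) by (simp add: val_def)
      have "v (poly p x - poly p (s n)) = v (poly (H i) (s n) * (x - s n) ^ i)"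
        unfolding diff[of x "s n"]
      proof (rule v_sum_eq)
        fix k assume "k \<in> S - {i}"
        then show "v (poly (H i) (s n) * (x - s n) ^ i) < v (poly (H k) (s n) * (x - s n) ^ k)"
          using summand[OF that(1) i(1) \<open>x \<noteq> s n\<close>]
            summand[OF that(1) _ \<open>x \<noteq> s n\<close>, of k] N(2)[OF that(1), of k]
          by (simp add: v_eq_val \<delta>)
      qed (use i(1) summand[OF that(1) i(1) \<open>x \<noteq> s n\<close>] in auto)
      also have "\<dots> = \<theta> n"
        using summand[OF that(1) i(1) \<open>x \<noteq> s n\<close>] by (simp add: v_eq_val \<delta> \<theta>_def)
      finally show ?thesis .
    qed
    show ?thesis
    \<comment> \<open>If some value lies below \<open>\<theta> n\<close>, the later differences have
      value at least \<open>\<theta> n\<close> and cannot alter it. Otherwise the values coincide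
      with \<open>\<theta>\<close> and increase.\<close>
    proof (cases "\<exists>n\<ge>N. v (poly p (s n)) < \<theta> n")
      case True
      then obtain n where n: "n \<ge> N" "v (poly p (s n)) < \<theta> n" by blast
      have const: "v (poly p (s m)) = v (poly p (s n))" if "m \<ge> n" for m
      proof (cases "m = n")
        case False
        then have "v (poly p (s m) - poly p (s n)) = \<theta> n"
          using diff_eq[OF n(1)] v_diff_eq_step[of n m] that v_step by simp
        then show ?thesis
          using n(2) by (intro v_eq_if_diff) simp
      qed simp
      have "v (poly p x) = v (poly p (s n))" if "v (s (Suc n) - s n) < v (x - s (Suc n))" for x
      proof -
        have "\<theta> n \<le> v (poly p x - poly p (s (Suc n)))"
          using that n(1) by (intro diff_ge) (auto simp: v_step)
        then have "v (poly p x) = v (poly p (s (Suc n)))"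
          using n(2) const[of "Suc n"] by (intro v_eq_if_diff) simp
        then show ?thesis using const[of "Suc n"] by simp
      qed
      then show ?thesis using const by blast
    next
      case False
      then have ge: "\<theta> n \<le> v (poly p (s n))" if "n \<ge> N" for n
        using that by (auto simp: not_less)
      \<comment> \<open>In \<open>p (s n) = (p (s n) - p (s (Suc n))) + p (s (Suc n))\<close> the
        first summand has value \<open>\<theta> n\<close> and the second a larger one.\<close>
      have eq: "v (poly p (s n)) = \<theta> n" if "n \<ge> N" for n
      proof -
        have *: "v (poly p (s n) - poly p (s (Suc n))) = \<theta> n"
          using diff_eq[OF that v_step] by (simp add: v_diff_commute)
        have "ereal (\<theta> n) < v (poly p (s (Suc n)))"
          using \<theta>_less[of n] ge[of "Suc n"] that by (auto intro: less_le_trans[of _ "ereal (\<theta> (Suc n))"])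
        then have "v (poly p (s n) - poly p (s (Suc n))) <
            v (poly p (s n) - (poly p (s n) - poly p (s (Suc n))))"
          using * by simp
        from v_eq_if_diff[OF this] show ?thesis using * by simp
      qed
      then show ?thesis
        using \<theta>_less by (intro disjI2 exI[of _ N]) auto
    qed
  qed
qed

end

text \<open>In Kaplansky's terminology, such a \<open>q\<close> exists for a pseudo-convergent
  \<open>s\<close> exactly when \<open>s\<close> is of algebraic type.\<close>

definition key_polynomial :: "(nat \<Rightarrow> 'a) \<Rightarrow> 'a poly \<Rightarrow> bool" where
  "key_polynomial s q \<longleftrightarrow> \<not> stable s q \<and> (\<forall>p. degree p < degree q \<longrightarrow> stable s p)"

lemma exists_key_polynomial:
  assumes "\<not> stable s p"
  shows "\<exists>q. key_polynomial s q"
  using ex_has_least_nat[of "\<lambda>p. \<not> stable s p" p degree] assms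
  unfolding key_polynomial_def by (meson not_le)

lemma degree_key_polynomial: "key_polynomial s q \<Longrightarrow> degree q > 0"
proof (rule ccontr)
  assume "key_polynomial s q" "\<not> degree q > 0"
  then obtain a where "q = [:a:]"
    using degree_eq_zeroE by blast
  then have "stable s q" by (auto simp: stable_def)
  then show False
    using \<open>key_polynomial s q\<close> by (simp add: key_polynomial_def)
qed

lemma key_polynomial_increasing:
  assumes "pseudo_convergent v s" "key_polynomial s q"
  shows "\<exists>N. \<forall>n\<ge>N. v (poly q (s n)) < v (poly q (s (Suc n)))"
proof -
  have "\<not> (\<exists>n \<gamma>. \<forall>m\<ge>n. v (poly q (s m)) = \<gamma>)"
    using assms(2) unfolding key_polynomial_def stable_def eventually_sequentially by blast
  then show ?thesis
    using kaplansky_dichotomy[OF assms(1), of q] assms(2) unfolding key_polynomial_def by blast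
qed

text \<open>Each term has a value affine in \<open>e\<close>. If several terms share the minimum,
  cancellation may raise the value of the sum and only the bound remains; a unique minimum gives
  equality.\<close>

lemma expansion_value:
  fixes b :: "nat \<Rightarrow> 'a"
  assumes p: "p = (\<Sum>k\<in>S. A k * q ^ k)" and "finite S" "i \<in> S" "poly q x \<noteq> 0"
    and b: "\<And>k. k \<in> S \<Longrightarrow> b k \<noteq> 0" "\<And>k. k \<in> S \<Longrightarrow> v (poly (A k) x) = v (b k)"
    and e: "e = val (poly q x)"
  shows "(\<forall>k\<in>S. val (b i) + i * e \<le> val (b k) + k * e) \<Longrightarrow> ereal (val (b i) + i * e) \<le> v (poly p x)"
    and "(\<forall>k\<in>S-{i}. val (b i) + i * e < val (b k) + k * e) \<Longrightarrow> v (poly p x) = ereal (val (b i) + i * e)"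
proof -
  let ?t = "\<lambda>k. poly (A k) x * poly q x ^ k"
  have px: "poly p x = sum ?t S"
    unfolding p by (simp add: poly_sum)
  have t: "?t k \<noteq> 0" "v (?t k) = ereal (val (b k) + k * e)" if "k \<in> S" for k
  proof -
    have "poly (A k) x \<noteq> 0" "val (poly (A k) x) = val (b k)"
      using b[OF that] by (auto simp: val_def)
    then show "?t k \<noteq> 0" "v (?t k) = ereal (val (b k) + k * e)"
      using assms(4) by (auto simp: v_eq_val val_mult val_power e)
  qed
  show "(\<forall>k\<in>S. val (b i) + i * e \<le> val (b k) + k * e) \<Longrightarrow> ereal (val (b i) + i * e) \<le> v (poly p x)"
    unfolding px using \<open>finite S\<close> t by (intro v_sum_ge) auto
  assume "\<forall>k\<in>S-{i}. val (b i) + i * e < val (b k) + k * e"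
  then have "v (sum ?t S) = v (?t i)"
    using \<open>finite S\<close> \<open>i \<in> S\<close> t by (intro v_sum_eq) auto
  then show "v (poly p x) = ereal (val (b i) + i * e)"
    using px t \<open>i \<in> S\<close> by simp
qed

text \<open>The digits have smaller degree than \<open>q\<close>, so their values stabilise, while
  the values of \<open>q\<close> increase strictly. Zero digits are left out of \<open>S\<close>, as
  they have no finite value.\<close>

lemma key_expansion:
  assumes "pseudo_convergent v s" "key_polynomial s q" "p \<noteq> 0"
  obtains S A and b :: "nat \<Rightarrow> 'a" and i where "finite S" "i \<in> S" "p = (\<Sum>k\<in>S. A k * q ^ k)"
    "\<And>k. k \<in> S \<Longrightarrow> b k \<noteq> 0" "\<And>k. k \<in> S \<Longrightarrow> degree (A k) < degree q"
    "\<And>k. k \<in> S \<Longrightarrow> \<forall>\<^sub>F n in sequentially. v (poly (A k) (s n)) = v (b k)"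
    "\<forall>\<^sub>F n in sequentially. \<forall>k\<in>S-{i}.
      val (b i) + i * val (poly q (s n)) < val (b k) + k * val (poly q (s n))"
proof -
  obtain A m where A: "p = (\<Sum>k\<le>m. A k * q ^ k)" "\<And>k. degree (A k) < degree q"
    using adic_expansion[OF degree_key_polynomial[OF assms(2)]] by blast
  define S where "S = {k. k \<le> m \<and> A k \<noteq> 0}"
  have [simp]: "finite S" by (simp add: S_def)
  have p: "p = (\<Sum>k\<in>S. A k * q ^ k)"
    unfolding A(1) by (rule sum.mono_neutral_right) (auto simp: S_def)
  then have "S \<noteq> {}" using assms(3) by auto
  have "\<exists>b. b \<noteq> 0 \<and> (\<forall>\<^sub>F n in sequentially. v (poly (A k) (s n)) = v b)" if "k \<in> S" for k
    using that A(2) assms(2) by (intro stable_value[OF assms(1)]) (auto simp: S_def key_polynomial_def)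
  then obtain b :: "nat \<Rightarrow> 'a" where b: "\<And>k. k \<in> S \<Longrightarrow> b k \<noteq> 0"
    "\<And>k. k \<in> S \<Longrightarrow> \<forall>\<^sub>F n in sequentially. v (poly (A k) (s n)) = v (b k)"
    by metis
  obtain N where N: "\<And>n. n \<ge> N \<Longrightarrow> v (poly q (s n)) < v (poly q (s (Suc n)))"
    using key_polynomial_increasing[OF assms(1,2)] by blast
  have fin: "poly q (s n) \<noteq> 0" if "n \<ge> N" for n
    using N[OF that] by auto
  have "val (poly q (s n)) < val (poly q (s (Suc n)))" if "n \<ge> N" for n
    using N[OF that] fin[OF that] fin[of "Suc n"] that by (simp add: v_eq_val)
  then obtain i where "i \<in> S" "\<forall>\<^sub>F n in sequentially. \<forall>k\<in>S-{i}.
      val (b i) + i * val (poly q (s n)) < val (b k) + k * val (poly q (s n))"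
    using eventually_affine_dominant[OF \<open>finite S\<close> \<open>S \<noteq> {}\<close>,
        where \<epsilon> = "\<lambda>n. val (poly q (s n))" and N = N and \<gamma> = "\<lambda>k. val (b k)"]
    by blast
  then show ?thesis
    using p b A(2) by (intro that[of S i A b]) (auto simp: S_def)
qed

text \<open>An unstable \<open>p\<close> eventually has the value of its dominant term, an affine
  function of slope \<open>i \<ge> 0\<close> in the increasing values of \<open>q\<close>.\<close>

lemma poly_values_mono:
  assumes pc: "pseudo_convergent v s"
  shows "\<exists>N. \<forall>n\<ge>N. \<forall>m\<ge>n. v (poly p (s n)) \<le> v (poly p (s m))"
proof (cases "stable s p \<or> p = 0")
  case True
  then show ?thesis
  proof
    assume "stable s p"
    then obtain \<gamma> N where "\<And>n. n \<ge> N \<Longrightarrow> v (poly p (s n)) = \<gamma>"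
      unfolding stable_def eventually_sequentially by blast
    then show ?thesis by (intro exI[of _ N]) simp
  qed simp
next
  case False
  then obtain q where q: "key_polynomial s q"
    using exists_key_polynomial by blast
  have "p \<noteq> 0" using False by simp
  obtain S A and b :: "nat \<Rightarrow> 'a" and i where *: "finite S" "i \<in> S" "p = (\<Sum>k\<in>S. A k * q ^ k)"
    "\<And>k. k \<in> S \<Longrightarrow> b k \<noteq> 0" "\<And>k. k \<in> S \<Longrightarrow> degree (A k) < degree q"
    "\<And>k. k \<in> S \<Longrightarrow> \<forall>\<^sub>F n in sequentially. v (poly (A k) (s n)) = v (b k)"
    "\<forall>\<^sub>F n in sequentially. \<forall>k\<in>S-{i}.
      val (b i) + i * val (poly q (s n)) < val (b k) + k * val (poly q (s n))"
    by (rule key_expansion[OF pc q \<open>p \<noteq> 0\<close>]) (rule that)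
  have "\<forall>\<^sub>F n in sequentially. \<forall>k\<in>S. v (poly (A k) (s n)) = v (b k)"
    using *(1,6) by (simp add: eventually_ball_finite)
  moreover have "\<forall>\<^sub>F n in sequentially. v (poly q (s n)) < v (poly q (s (Suc n)))"
    using key_polynomial_increasing[OF pc q] by (simp add: eventually_sequentially)
  ultimately have "\<forall>\<^sub>F n in sequentially. (\<forall>k\<in>S. v (poly (A k) (s n)) = v (b k)) \<and>
      v (poly q (s n)) < v (poly q (s (Suc n))) \<and>
      (\<forall>k\<in>S-{i}. val (b i) + i * val (poly q (s n)) < val (b k) + k * val (poly q (s n)))"
    using *(7) by eventually_elim simp
  then obtain N where N: "\<And>n. n \<ge> N \<Longrightarrow> (\<forall>k\<in>S. v (poly (A k) (s n)) = v (b k)) \<and>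
      v (poly q (s n)) < v (poly q (s (Suc n))) \<and>
      (\<forall>k\<in>S-{i}. val (b i) + i * val (poly q (s n)) < val (b k) + k * val (poly q (s n)))"
    unfolding eventually_sequentially by blast
  have fin: "poly q (s n) \<noteq> 0" if "n \<ge> N" for n
    using N[OF that] by auto
  have eq: "v (poly p (s n)) = ereal (val (b i) + i * val (poly q (s n)))" if "n \<ge> N" for n
    using expansion_value(2)[OF *(3,1,2) fin[OF that] *(4)] N[OF that] by simp
  have mono_Suc: "v (poly p (s n)) \<le> v (poly p (s (Suc n)))" if "n \<ge> N" for n
  proof -
    have "val (poly q (s n)) \<le> val (poly q (s (Suc n)))"
      using N[OF that] fin[OF that] fin[of "Suc n"] that by (simp add: v_eq_val)
    then show ?thesis
      using eq[OF that] eq[of "Suc n"] that by (simp add: mult_left_mono)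
  qed
  have "v (poly p (s n)) \<le> v (poly p (s m))" if "n \<ge> N" "n \<le> m" for n m
    using that(2)
  proof (induction m rule: dec_induct)
    case (step m)
    then show ?case
      using mono_Suc[of m] \<open>n \<ge> N\<close> by (auto intro: order_trans)
  qed simp
  then show ?thesis by blast
qed

end

text \<open>The difference of two affine functions is affine, so an inequality at both ends of an
  interval holds inside.\<close>

lemma affine_between:
  fixes a b x :: real
  assumes "a \<le> x" "x \<le> b"
  shows "p + i * a < p' + k * a \<Longrightarrow> p + i * b < p' + k * b \<Longrightarrow> p + i * x < p' + k * x"
    and "p + i * a \<le> p' + k * a \<Longrightarrow> p + i * b \<le> p' + k * b \<Longrightarrow> p + i * x \<le> p' + k * x"
proof -
  have "(i - k) * x \<le> (i - k) * b \<or> (i - k) * x \<le> (i - k) * a"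
    using assms by (cases "0 \<le> i - k") (auto intro: mult_left_mono mult_left_mono_neg)
  then show "p + i * a < p' + k * a \<Longrightarrow> p + i * b < p' + k * b \<Longrightarrow> p + i * x < p' + k * x"
    "p + i * a \<le> p' + k * a \<Longrightarrow> p + i * b \<le> p' + k * b \<Longrightarrow> p + i * x \<le> p' + k * x"
    by (auto simp: algebra_simps)
qed

section \<open>The Zariski topology and clopen conditions\<close>

context real_valued_field
begin

abbreviation \<V> :: "'a poly fract set set" where
  "\<V> \<equiv> V_space (valuation_ring v) v"

abbreviation \<D> :: "(nat \<Rightarrow> 'a) \<Rightarrow> 'a poly fract set" where
  "\<D> \<equiv> V_dom (valuation_ring v)"

abbreviation X :: "'a poly fract set topology" where
  "X \<equiv> zariski_topology \<V>"

lemma mem_V_dom_Fract: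
  assumes "pseudo_convergent v s" "h \<noteq> 0"
  shows "Fraction_Field.Fract g h \<in> \<D> s \<longleftrightarrow>
    (\<forall>\<^sub>F n in sequentially. v (poly h (s n)) \<le> v (poly g (s n)))"
proof -
  have "\<forall>\<^sub>F n in sequentially. eval_ratfun (Fraction_Field.Fract g h) (s n) \<in> valuation_ring v \<longleftrightarrow>
      v (poly h (s n)) \<le> v (poly g (s n))"
    using eventually_poly_nonzero[OF assms]
    by eventually_elim (simp add: eval_ratfun_Fract valuation_ring_def v_le_quotient_iff)
  then show ?thesis
    unfolding V_dom_def by (simp add: eventually_subst)
qed

lemma topspace_X [simp]: "topspace X = \<V>"
proof (rule topspace_zariski_topology)
  have "Fraction_Field.Fract 0 1 \<in> \<D> s" if "pseudo_convergent v s" for s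
    using that by (simp add: mem_V_dom_Fract)
  then show "{} \<notin> \<V>"
    unfolding V_space_def by force
qed

lemma openin_basic: "openin X {U \<in> \<V>. \<phi> \<in> U}"
  unfolding zariski_topology_def by (rule topology_generated_by_Basis) blast

text \<open>The values are eventually nondecreasing: once one of them is finite and exceeds
  \<open>v c\<close>, its excess persists and serves as \<open>e\<close>. This fixed gap is what
  makes the complement of a basic set open.\<close>

lemma eventually_le_or_gt:
  assumes pc: "pseudo_convergent v s" and "f \<noteq> 0" "c \<noteq> 0"
  shows "(\<forall>\<^sub>F n in sequentially. v (poly f (s n)) \<le> v c) \<or>
    (\<exists>e>0. \<forall>\<^sub>F n in sequentially. ereal (val c + e) \<le> v (poly f (s n)))"
proof (rule disjCI)
  assume *: "\<not> (\<exists>e>0. \<forall>\<^sub>F n in sequentially. ereal (val c + e) \<le> v (poly f (s n)))"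
  obtain N where N: "\<And>n m. N \<le> n \<Longrightarrow> n \<le> m \<Longrightarrow> v (poly f (s n)) \<le> v (poly f (s m))"
    using poly_values_mono[OF pc] by blast
  have "v (poly f (s n)) \<le> v c" if "N \<le> n" "poly f (s n) \<noteq> 0" for n
  proof (rule ccontr)
    assume "\<not> v (poly f (s n)) \<le> v c"
    then have "val (poly f (s n)) - val c > 0"
      using that \<open>c \<noteq> 0\<close> by (simp add: v_eq_val)
    moreover have "\<forall>\<^sub>F m in sequentially.
        ereal (val c + (val (poly f (s n)) - val c)) \<le> v (poly f (s m))"
      using N[OF that(1)] that(2) v_eq_val
      by (intro eventually_mono[OF eventually_ge_at_top[of n]]) simp
    ultimately show False using * by blast
  qed
  moreover have "\<forall>\<^sub>F n in sequentially. N \<le> n \<and> poly f (s n) \<noteq> 0"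
    using eventually_poly_nonzero[OF pc \<open>f \<noteq> 0\<close>] eventually_ge_at_top by (auto intro: eventually_conj)
  ultimately show "\<forall>\<^sub>F n in sequentially. v (poly f (s n)) \<le> v c"
    by (auto elim: eventually_mono)
qed

text \<open>Successive steps of \<open>s\<close> have increasing values, so the quotient of two of
  them is a witness.\<close>

lemma exists_positive_val:
  assumes "pseudo_convergent v s"
  shows "\<exists>d. d \<noteq> 0 \<and> val d > 0"
proof -
  let ?a = "s (Suc 0) - s 0" and ?b = "s (Suc (Suc 0)) - s (Suc 0)"
  have "?a \<noteq> 0" "?b \<noteq> 0"
    using step_nonzero[OF assms] by auto
  moreover have "v ?a < v ?b"
    using step_less[OF assms] by simp
  ultimately show ?thesis
    by (intro exI[of _ "?b / ?a"]) (simp add: val_divide v_eq_val)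
qed

text \<open>Outside the set the values of \<open>f\<close> exceed \<open>v c\<close> by a fixed gap.
  Openness of the complement amounts to expressing such a gap by a rational function.\<close>

lemma closedin_basic_inverse_poly:
  assumes "f \<noteq> 0" "c \<noteq> 0"
  shows "closedin X {U \<in> \<V>. Fraction_Field.Fract [:c:] f \<in> U}" 
    (is "closedin X ?D")
proof -
  have "\<exists>T. openin X T \<and> U \<in> T \<and> T \<subseteq> \<V> - ?D" if U: "U \<in> \<V> - ?D" for U
  proof -
    obtain s where s: "pseudo_convergent v s" "U = \<D> s"
      using U unfolding V_space_def by blast
    have "Fraction_Field.Fract [:c:] f \<notin> \<D> s"
      using U s by auto
    then obtain e where e: "e > 0" "\<forall>\<^sub>F n in sequentially. ereal (val c + e) \<le> v (poly f (s n))"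
      using eventually_le_or_gt[OF s(1) assms] by (auto simp: mem_V_dom_Fract[OF s(1) assms(1)])
    obtain d where d: "d \<noteq> 0" "val d > 0"
      using exists_positive_val[OF s(1)] by blast
    \<comment> \<open>The gap \<open>e\<close> need not be a value. Passing to \<open>f ^ k\<close>
      enlarges it beyond \<open>val d\<close>, and then \<open>c ^ k * d\<close> separates the two
      sides.\<close>
    obtain k where k: "val d < of_nat k * e"
      using reals_Archimedean3[OF e(1)] by blast
    let ?c = "c ^ k * d"
    have c: "?c \<noteq> 0" "val ?c = k * val c + val d"
      using d assms(2) by (simp_all add: val_mult val_power)
    let ?T = "{U \<in> \<V>. Fraction_Field.Fract (f ^ k) [:?c:] \<in> U}"
    have "\<forall>\<^sub>F n in sequentially. v ?c \<le> v (poly (f ^ k) (s n))"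
      using e(2) eventually_poly_nonzero[OF s(1) assms(1)]
    proof eventually_elim
      case (elim n)
      then have "k * (val c + e) \<le> k * val (poly f (s n))"
        by (intro mult_left_mono) (simp_all add: v_eq_val)
      then show ?case
        using c k elim(2) by (simp add: v_eq_val val_power poly_power algebra_simps)
    qed
    then have "U \<in> ?T"
      using U s c(1) mem_V_dom_Fract[OF s(1), of "[:?c:]" "f ^ k"] by simp
    moreover have "?T \<subseteq> \<V> - ?D"
    proof clarify
      fix U assume U': "U \<in> \<V>" "Fraction_Field.Fract (f ^ k) [:?c:] \<in> U"
        "Fraction_Field.Fract [:c:] f \<in> U"
      then obtain t where t: "pseudo_convergent v t" "U = \<D> t"
        using U'(1) unfolding V_space_def by blast
      have "\<forall>\<^sub>F n in sequentially. v ?c \<le> v (poly (f ^ k) (t n))"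
        using U'(2) t c(1) mem_V_dom_Fract[OF t(1), of "[:?c:]" "f ^ k"] by simp
      moreover have "\<forall>\<^sub>F n in sequentially. v (poly f (t n)) \<le> v c"
        using U'(3) t mem_V_dom_Fract[OF t(1) assms(1), of "[:c:]"] by simp
      ultimately have "\<forall>\<^sub>F n in sequentially. False"
        using eventually_poly_nonzero[OF t(1) assms(1)]
      proof eventually_elim
        case (elim n)
        then have "k * val (poly f (t n)) \<le> k * val c"
          using assms(2) by (intro mult_left_mono) (simp_all add: v_eq_val)
        then show ?case
          using elim c d by (simp add: v_eq_val val_power poly_power)
      qed
      then show False by simp
    qed
    ultimately show ?thesis
      using openin_basic by blast
  qed
  then have "openin X (\<V> - ?D)"
    by (subst openin_subopen) blast
  then show ?thesis
    unfolding closedin_def by auto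
qed

text \<open>This separates topology from arithmetic: such conditions can be weakened and finitely
  conjoined, so a claim about the rings near \<open>\<D> s\<close> reduces to an inequality at a
  single element \<open>x\<close>, not necessarily a term of \<open>s\<close>.\<close>

definition clopen_nbhd :: "(nat \<Rightarrow> 'a) \<Rightarrow> ('a \<Rightarrow> bool) \<Rightarrow> bool" where
  "clopen_nbhd s P \<longleftrightarrow> (\<exists>D. openin X D \<and> closedin X D \<and> \<D> s \<in> D \<and>
    (\<forall>t. pseudo_convergent v t \<longrightarrow> \<D> t \<in> D \<longrightarrow> (\<forall>\<^sub>F n in sequentially. P (t n))))"

lemma clopen_nbhd_mono:
  assumes "clopen_nbhd s P" "\<And>x. P x \<Longrightarrow> Q x"
  shows "clopen_nbhd s Q"
proof -
  obtain D where "openin X D" "closedin X D" "\<D> s \<in> D"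
    and P: "\<And>t. pseudo_convergent v t \<Longrightarrow> \<D> t \<in> D \<Longrightarrow> \<forall>\<^sub>F n in sequentially. P (t n)"
    using assms(1) unfolding clopen_nbhd_def by blast
  moreover have "\<forall>\<^sub>F n in sequentially. Q (t n)" if "pseudo_convergent v t" "\<D> t \<in> D" for t
    using P[OF that] assms(2) by (rule eventually_mono)
  ultimately show ?thesis
    unfolding clopen_nbhd_def by blast
qed

lemma clopen_nbhd_conj:
  assumes "clopen_nbhd s P" "clopen_nbhd s Q"
  shows "clopen_nbhd s (\<lambda>x. P x \<and> Q x)"
proof -
  obtain D E where
    "openin X D" "closedin X D" "\<D> s \<in> D"
    "\<forall>t. pseudo_convergent v t \<longrightarrow> \<D> t \<in> D \<longrightarrow> (\<forall>\<^sub>F n in sequentially. P (t n))"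
    "openin X E" "closedin X E" "\<D> s \<in> E"
    "\<forall>t. pseudo_convergent v t \<longrightarrow> \<D> t \<in> E \<longrightarrow> (\<forall>\<^sub>F n in sequentially. Q (t n))"
    using assms unfolding clopen_nbhd_def by blast
  then show ?thesis
    unfolding clopen_nbhd_def by (intro exI[of _ "D \<inter> E"]) (auto intro: eventually_conj)
qed

lemma clopen_nbhd_eventually:
  assumes "pseudo_convergent v s" "\<And>t. pseudo_convergent v t \<Longrightarrow> \<forall>\<^sub>F n in sequentially. P (t n)"
  shows "clopen_nbhd s P"
proof -
  have "openin X \<V>" "closedin X \<V>"
    using openin_topspace[of X] closedin_topspace[of X] by simp_all
  moreover have "\<D> s \<in> \<V>"
    using assms(1) by (auto simp: V_space_def)
  ultimately show ?thesis
    unfolding clopen_nbhd_def using assms(2) by blast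
qed

lemma clopen_nbhd_ball:
  assumes "pseudo_convergent v s" "finite S" "\<And>k. k \<in> S \<Longrightarrow> clopen_nbhd s (P k)"
  shows "clopen_nbhd s (\<lambda>x. \<forall>k\<in>S. P k x)"
  using assms(2,3)
proof (induction S rule: finite_induct)
  case empty
  then show ?case using assms(1) by (auto intro: clopen_nbhd_eventually)
next
  case (insert k S)
  then have "clopen_nbhd s (\<lambda>x. P k x \<and> (\<forall>k\<in>S. P k x))"
    by (intro clopen_nbhd_conj) auto
  then show ?case by simp
qed

lemma clopen_nbhd_nonzero:
  assumes "pseudo_convergent v s" "p \<noteq> 0"
  shows "clopen_nbhd s (\<lambda>x. poly p x \<noteq> 0)"
  using assms(1) eventually_poly_nonzero[OF _ assms(2)] by (rule clopen_nbhd_eventually)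

lemma clopen_nbhd_le:
  assumes "pseudo_convergent v s" "f \<noteq> 0" "c \<noteq> 0"
    and "\<forall>\<^sub>F n in sequentially. v (poly f (s n)) \<le> v c"
  shows "clopen_nbhd s (\<lambda>x. v (poly f x) \<le> v c)"
proof -
  let ?D = "{U \<in> \<V>. Fraction_Field.Fract [:c:] f \<in> U}"
  have "\<D> s \<in> ?D"
    using assms mem_V_dom_Fract[OF assms(1,2), of "[:c:]"] by (auto simp: V_space_def)
  moreover have "\<forall>\<^sub>F n in sequentially. v (poly f (t n)) \<le> v c"
    if "pseudo_convergent v t" "\<D> t \<in> ?D" for t
    using that mem_V_dom_Fract[OF that(1) assms(2), of "[:c:]"] by auto
  ultimately show ?thesis
    unfolding clopen_nbhd_def
    using openin_basic closedin_basic_inverse_poly[OF assms(2,3)] by blast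
qed

text \<open>The complement of a clopen basic set is used. The gap from
  \<open>eventually_le_or_gt\<close> turns nonmembership, a negated eventual statement, into an
  eventual strict inequality.\<close>

lemma clopen_nbhd_gt:
  assumes "pseudo_convergent v s" "f \<noteq> 0" "c \<noteq> 0"
    and "\<forall>\<^sub>F n in sequentially. v c < v (poly f (s n))"
  shows "clopen_nbhd s (\<lambda>x. v c < v (poly f x))"
proof -
  let ?D = "{U \<in> \<V>. Fraction_Field.Fract [:c:] f \<in> U}"
  have "\<D> s \<notin> ?D"
  proof
    assume "\<D> s \<in> ?D"
    then have "\<forall>\<^sub>F n in sequentially. v (poly f (s n)) \<le> v c"
      using mem_V_dom_Fract[OF assms(1,2), of "[:c:]"] by auto
    with assms(4) have "\<forall>\<^sub>F n in sequentially. False"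
      by eventually_elim simp
    then show False by simp
  qed
  then have "\<D> s \<in> \<V> - ?D"
    using assms(1) by (auto simp: V_space_def)
  moreover have "\<forall>\<^sub>F n in sequentially. v c < v (poly f (t n))"
    if t: "pseudo_convergent v t" "\<D> t \<in> \<V> - ?D" for t
  proof -
    have "Fraction_Field.Fract [:c:] f \<notin> \<D> t"
      using t(2) by auto
    then obtain e where "e > 0" "\<forall>\<^sub>F n in sequentially. ereal (val c + e) \<le> v (poly f (t n))"
      using eventually_le_or_gt[OF t(1) assms(2,3)]
      by (auto simp: mem_V_dom_Fract[OF t(1) assms(2)])
    moreover have "v c < ereal (val c + e)"
      using \<open>e > 0\<close> assms(3) by (simp add: v_eq_val)
    ultimately show ?thesis
      by (auto elim!: eventually_mono intro: less_le_trans)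
  qed
  moreover have "openin X (\<V> - ?D)" "closedin X (\<V> - ?D)"
    using closedin_basic_inverse_poly[OF assms(2,3)] openin_basic
    by (auto simp: closedin_def double_diff)
  ultimately show ?thesis
    unfolding clopen_nbhd_def by blast
qed

text \<open>Nonvanishing of \<open>f\<close> is conjoined because at a root \<open>val\<close> has
  its default value while \<open>v\<close> is infinite.\<close>

lemma clopen_nbhd_val_gt:
  assumes "pseudo_convergent v s" "f \<noteq> 0" "c \<noteq> 0"
    and "\<forall>\<^sub>F n in sequentially. val c < val (poly f (s n))"
  shows "clopen_nbhd s (\<lambda>x. val c < val (poly f x))"
proof -
  have "\<forall>\<^sub>F n in sequentially. v c < v (poly f (s n))"
    using assms(4) eventually_poly_nonzero[OF assms(1,2)]
    by eventually_elim (simp add: v_eq_val \<open>c \<noteq> 0\<close>)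
  then have "clopen_nbhd s (\<lambda>x. v c < v (poly f x) \<and> poly f x \<noteq> 0)"
    using assms by (intro clopen_nbhd_conj clopen_nbhd_gt clopen_nbhd_nonzero)
  then show ?thesis
    by (rule clopen_nbhd_mono) (auto simp: v_eq_val \<open>c \<noteq> 0\<close>)
qed

text \<open>Passing to \<open>f ^ k\<close> expresses the bound \<open>val c / k\<close>, which need
  not be a value, by the constant \<open>c\<close>.\<close>

lemma clopen_nbhd_multiple_val_le:
  fixes k :: nat
  assumes "pseudo_convergent v s" "f \<noteq> 0" "c \<noteq> 0"
    and "\<forall>\<^sub>F n in sequentially. k * val (poly f (s n)) \<le> val c"
  shows "clopen_nbhd s (\<lambda>x. k * val (poly f x) \<le> val c)"
proof -
  have "\<forall>\<^sub>F n in sequentially. v (poly (f ^ k) (s n)) \<le> v c"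
    using assms(4) eventually_poly_nonzero[OF assms(1,2)]
    by eventually_elim (simp add: v_eq_val \<open>c \<noteq> 0\<close> val_power poly_power)
  then have "clopen_nbhd s (\<lambda>x. v (poly (f ^ k) x) \<le> v c \<and> poly f x \<noteq> 0)"
    using assms by (intro clopen_nbhd_conj clopen_nbhd_le clopen_nbhd_nonzero) auto
  then show ?thesis
    by (rule clopen_nbhd_mono) (auto simp: v_eq_val \<open>c \<noteq> 0\<close> val_power poly_power)
qed

text \<open>By the dichotomy, \<open>p\<close> has constant value on a ball around
  \<open>s (Suc n)\<close>, and lying in that ball is a clopen condition on the linear polynomial
  \<open>X - s (Suc n)\<close>.\<close>

lemma clopen_nbhd_stable_value:
  assumes pc: "pseudo_convergent v s" and "\<And>p'. degree p' < degree p \<Longrightarrow> stable s p'"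
    and b: "\<forall>\<^sub>F n in sequentially. v (poly p (s n)) = v b"
  shows "clopen_nbhd s (\<lambda>x. v (poly p x) = v b)"
proof -
  have "\<not> (\<exists>N. \<forall>n\<ge>N. v (poly p (s n)) < v (poly p (s (Suc n))))"
  proof
    assume "\<exists>N. \<forall>n\<ge>N. v (poly p (s n)) < v (poly p (s (Suc n)))"
    then have "\<forall>\<^sub>F n in sequentially. v (poly p (s n)) < v (poly p (s (Suc n)))"
      by (simp add: eventually_sequentially)
    \<comment> \<open>The shifted hypothesis also gives the value at \<open>Suc n\<close>, so the
      increase would read \<open>v b < v b\<close>.\<close>
    with b eventually_sequentially_Suc[THEN iffD2, OF b] have "\<forall>\<^sub>F n in sequentially. False"
      by eventually_elim simp
    then show False by simp
  qed
  then obtain n \<gamma> where \<gamma>: "\<And>m. m \<ge> n \<Longrightarrow> v (poly p (s m)) = \<gamma>"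
    "\<And>x. v (s (Suc n) - s n) < v (x - s (Suc n)) \<Longrightarrow> v (poly p x) = \<gamma>"
    using kaplansky_dichotomy[OF pc assms(2)] by blast
  have "\<forall>\<^sub>F n in sequentially. \<gamma> = v b"
    using b eventually_ge_at_top[of n] by eventually_elim (simp add: \<gamma>(1))
  then have "\<gamma> = v b" by simp
  have "\<forall>\<^sub>F m in sequentially. v (s (Suc n) - s n) < v (poly [:- s (Suc n), 1:] (s m))"
    using eventually_gt_at_top[of "Suc n"]
  proof eventually_elim
    case (elim m)
    then show ?case
      using v_diff_eq_step[OF pc elim] step_less[OF pc, of n "Suc n"] by simp
  qed
  then have "clopen_nbhd s (\<lambda>x. v (s (Suc n) - s n) < v (poly [:- s (Suc n), 1:] x))"
    using step_nonzero[OF pc, of n] by (intro clopen_nbhd_gt pc) auto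
  then show ?thesis
    by (rule clopen_nbhd_mono) (use \<gamma>(2) \<open>\<gamma> = v b\<close> in simp)
qed

end

section \<open>Clopen sets inside a basic open set\<close>

context real_valued_field
begin

text \<open>Rational multiples of \<open>val d\<close> are dense in the reals, and \<open>k\<close>
  clears the denominator.\<close>

lemma rational_multiple_between:
  fixes \<delta> \<delta>' :: real
  assumes "d \<noteq> 0" "val d > 0" "\<delta> < \<delta>'"
  shows "\<exists>(k::nat) c. k > (0::nat) \<and> c \<noteq> 0 \<and> k * \<delta> < val c \<and> val c < k * \<delta>'"
proof -
  obtain r where r: "r \<in> \<rat>" "\<delta> / val d < r" "r < \<delta>' / val d"
    using Rats_dense_in_real[of "\<delta> / val d" "\<delta>' / val d"] assms
    by (auto simp: divide_strict_right_mono)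
  then obtain m n :: int where mn: "n > 0" "r = m / n"
    using Rats_cases' by metis
  define c where "c = (if m \<ge> 0 then d ^ nat m else inverse (d ^ nat (- m)))"
  have c: "c \<noteq> 0" "val c = m * val d"
    using assms(1) by (auto simp: c_def val_power val_inverse)
  have "n * \<delta> < m * val d" "m * val d < n * \<delta>'"
    using r(2,3) mn assms(2) by (simp_all add: field_simps)
  then show ?thesis
    using c mn(1) by (intro exI[of _ "nat n"] exI[of _ c]) simp
qed

text \<open>Solving the equation for \<open>\<delta>\<close>, the difference of the slopes is the
  multiplier and a quotient of \<open>a\<close> and \<open>b\<close> is the element.\<close>

lemma multiple_of_crossing:
  fixes i k :: nat and \<delta> :: real
  assumes "a \<noteq> 0" "b \<noteq> 0" "i \<noteq> k" "val a + i * \<delta> = val b + k * \<delta>"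
  shows "\<exists>(m::nat) c. m > (0::nat) \<and> c \<noteq> 0 \<and> m * \<delta> = val c"
proof (cases "i < k")
  case True
  then show ?thesis
    using assms by (intro exI[of _ "k - i"] exI[of _ "a / b"]) (simp add: val_divide algebra_simps of_nat_diff)
next
  case False
  then show ?thesis
    using assms by (intro exI[of _ "i - k"] exI[of _ "b / a"]) (simp add: val_divide algebra_simps of_nat_diff)
qed

text \<open>Once clopen conditions fix the values of all digits, only
  \<open>e = val (poly q x)\<close> still varies. Between the values of \<open>q\<close> along
  \<open>s\<close> convexity suffices; the work lies at their limit.\<close>

lemma clopen_nbhd_le_key:
  assumes pc: "pseudo_convergent v s" and q: "key_polynomial s q" and "g \<noteq> 0" "h \<noteq> 0"
    and le: "\<forall>\<^sub>F n in sequentially. v (poly h (s n)) \<le> v (poly g (s n))"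
  shows "clopen_nbhd s (\<lambda>x. v (poly h x) \<le> v (poly g x))"
proof -
  obtain S A and b :: "nat \<Rightarrow> 'a" and i where g: "finite S" "i \<in> S" "g = (\<Sum>k\<in>S. A k * q ^ k)"
    "\<And>k. k \<in> S \<Longrightarrow> b k \<noteq> 0" "\<And>k. k \<in> S \<Longrightarrow> degree (A k) < degree q"
    "\<And>k. k \<in> S \<Longrightarrow> \<forall>\<^sub>F n in sequentially. v (poly (A k) (s n)) = v (b k)"
    "\<forall>\<^sub>F n in sequentially. \<forall>k\<in>S-{i}.
      val (b i) + i * val (poly q (s n)) < val (b k) + k * val (poly q (s n))"
    by (rule key_expansion[OF pc q \<open>g \<noteq> 0\<close>]) (rule that)
  obtain T B and c :: "nat \<Rightarrow> 'a" and j where h: "finite T" "j \<in> T" "h = (\<Sum>k\<in>T. B k * q ^ k)"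
    "\<And>k. k \<in> T \<Longrightarrow> c k \<noteq> 0" "\<And>k. k \<in> T \<Longrightarrow> degree (B k) < degree q"
    "\<And>k. k \<in> T \<Longrightarrow> \<forall>\<^sub>F n in sequentially. v (poly (B k) (s n)) = v (c k)"
    "\<forall>\<^sub>F n in sequentially. \<forall>k\<in>T-{j}.
      val (c j) + j * val (poly q (s n)) < val (c k) + k * val (poly q (s n))"
    by (rule key_expansion[OF pc q \<open>h \<noteq> 0\<close>]) (rule that)
  define \<epsilon> where "\<epsilon> n = val (poly q (s n))" for n
  \<comment> \<open>The predicates concern an arbitrary real \<open>e\<close>, so that they can be
    carried from the values \<open>\<epsilon> n\<close> to other values of \<open>q\<close> and to
    the limit.\<close>
  define dom_g where "dom_g e \<longleftrightarrow> (\<forall>k\<in>S-{i}. val (b i) + i * e < val (b k) + k * e)" for e :: real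
  define dom_h where "dom_h e \<longleftrightarrow> (\<forall>k\<in>T-{j}. val (c j) + j * e < val (c k) + k * e)" for e :: real
  define ineq where "ineq e \<longleftrightarrow> val (c j) + j * e \<le> val (b i) + i * e" for e :: real
  \<comment> \<open>At such \<open>x\<close> all terms of both expansions have known values, and
    \<open>v (poly h x)\<close> is finite.\<close>
  define near where "near x \<longleftrightarrow> poly q x \<noteq> 0 \<and> poly h x \<noteq> 0 \<and>
    (\<forall>k\<in>S. v (poly (A k) x) = v (b k)) \<and> (\<forall>k\<in>T. v (poly (B k) x) = v (c k))" for x

  have "q \<noteq> 0"
    using degree_key_polynomial[OF q] by auto
  have lower_stable: "stable s p" if "degree p < degree q" for p
    using q that by (simp add: key_polynomial_def)
  have near_nbhd: "clopen_nbhd s near"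
    unfolding near_def
  proof (intro clopen_nbhd_conj clopen_nbhd_ball clopen_nbhd_nonzero clopen_nbhd_stable_value pc)
    show "stable s p'" if "k \<in> S" "degree p' < degree (A k)" for k p'
      using that g(5) by (meson less_trans lower_stable)
    show "stable s p'" if "k \<in> T" "degree p' < degree (B k)" for k p'
      using that h(5) by (meson less_trans lower_stable)
  qed (use g h \<open>q \<noteq> 0\<close> \<open>h \<noteq> 0\<close> in auto)
  have "\<forall>\<^sub>F n in sequentially. near (s n)"
    unfolding near_def
    using g(1,6) h(1,6) eventually_poly_nonzero[OF pc] \<open>q \<noteq> 0\<close> \<open>h \<noteq> 0\<close>
    by (intro eventually_conj) (simp_all add: eventually_ball_finite)
  moreover have "\<forall>\<^sub>F n in sequentially. v (poly q (s n)) < v (poly q (s (Suc n)))"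
    using key_polynomial_increasing[OF pc q] by (simp add: eventually_sequentially)
  ultimately have "\<forall>\<^sub>F n in sequentially. near (s n) \<and> v (poly q (s n)) < v (poly q (s (Suc n))) \<and>
      dom_g (\<epsilon> n) \<and> dom_h (\<epsilon> n) \<and> v (poly h (s n)) \<le> v (poly g (s n))"
    using g(7) h(7) le unfolding dom_g_def dom_h_def \<epsilon>_def by eventually_elim simp
  then obtain N where N: "\<And>n. n \<ge> N \<Longrightarrow> near (s n)"
    "\<And>n. n \<ge> N \<Longrightarrow> v (poly q (s n)) < v (poly q (s (Suc n)))"
    "\<And>n. n \<ge> N \<Longrightarrow> dom_g (\<epsilon> n)" "\<And>n. n \<ge> N \<Longrightarrow> dom_h (\<epsilon> n)"
    "\<And>n. n \<ge> N \<Longrightarrow> v (poly h (s n)) \<le> v (poly g (s n))"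
    unfolding eventually_sequentially by blast

  have value_g: "v (poly g x) = ereal (val (b i) + i * val (poly q x))"
    if "near x" "dom_g (val (poly q x))" for x
    using expansion_value(2)[OF g(3,1,2) _ g(4)] that unfolding near_def dom_g_def by simp
  have value_h: "v (poly h x) = ereal (val (c j) + j * val (poly q x))"
    if "near x" "dom_h (val (poly q x))" for x
    using expansion_value(2)[OF h(3,1,2) _ h(4)] that unfolding near_def dom_h_def by simp
  have ineq: "ineq (\<epsilon> n)" if "n \<ge> N" for n
    using N(5)[OF that] value_g[of "s n"] value_h[of "s n"] N(1,3,4)[OF that]
    by (simp add: ineq_def \<epsilon>_def)
  have \<epsilon>_Suc: "\<epsilon> n < \<epsilon> (Suc n)" if "n \<ge> N" for n
    using N(2)[OF that] N(1)[of n] N(1)[of "Suc n"] that by (simp add: near_def v_eq_val \<epsilon>_def)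
  have \<epsilon>_less: "\<epsilon> m < \<epsilon> n" if "N \<le> m" "m < n" for m n
    using that(2,1) by (induction rule: less_Suc_induct) (auto intro: \<epsilon>_Suc less_trans)
  \<comment> \<open>Dominance and the inequality hold at both \<open>\<epsilon> N\<close> and
    \<open>\<epsilon> n\<close>, hence at every value in between.\<close>
  have between: "v (poly h x) \<le> v (poly g x)"
    if "near x" "\<epsilon> N < val (poly q x)" "n \<ge> N" "val (poly q x) \<le> \<epsilon> n" for x n
  proof -
    let ?e = "val (poly q x)"
    have e: "\<epsilon> N \<le> ?e" "?e \<le> \<epsilon> n" using that by auto
    have "dom_g ?e"
      using N(3)[of N] N(3)[OF that(3)] affine_between(1)[OF e] unfolding dom_g_def by blast
    moreover have "dom_h ?e"
      using N(4)[of N] N(4)[OF that(3)] affine_between(1)[OF e] unfolding dom_h_def by blast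
    moreover have "ineq ?e"
      using ineq[of N] ineq[OF that(3)] affine_between(2)[OF e] unfolding ineq_def by blast
    ultimately show ?thesis
      using value_g[OF that(1)] value_h[OF that(1)] by (simp add: ineq_def)
  qed
  have lower_nbhd: "clopen_nbhd s (\<lambda>x. \<epsilon> N < val (poly q x))"
    unfolding \<epsilon>_def
  proof (rule clopen_nbhd_val_gt[OF pc \<open>q \<noteq> 0\<close>])
    show "poly q (s N) \<noteq> 0" using N(1)[of N] by (simp add: near_def)
    show "\<forall>\<^sub>F n in sequentially. val (poly q (s N)) < val (poly q (s n))"
      using \<epsilon>_less by (intro eventually_mono[OF eventually_gt_at_top[of N]]) (simp add: \<epsilon>_def)
  qed
  show ?thesis
  \<comment> \<open>If the values of \<open>q\<close> along \<open>s\<close> are unbounded, each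
    value above \<open>\<epsilon> N\<close> lies below some \<open>\<epsilon> n\<close>, and
    \<open>between\<close> settles the claim.\<close>
  proof (cases "\<forall>M. \<exists>n\<ge>N. M \<le> \<epsilon> n")
    case True
    show ?thesis
      by (rule clopen_nbhd_mono[OF clopen_nbhd_conj[OF near_nbhd lower_nbhd]]) (use True between in blast)
  next
    case False
    then obtain M where M: "\<And>n. n \<ge> N \<Longrightarrow> \<epsilon> n \<le> M"
      by (meson linear)
    have "\<exists>\<delta>. (\<lambda>n. \<epsilon> (n + N)) \<longlonglongrightarrow> \<delta>"
    proof (rule incseq_convergent[of "\<lambda>n. \<epsilon> (n + N)" M])
      show "incseq (\<lambda>n. \<epsilon> (n + N))"
        by (rule incseq_SucI) (simp add: \<epsilon>_Suc less_imp_le)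
    qed (use M in auto)
    then obtain \<delta> where \<delta>: "\<epsilon> \<longlonglongrightarrow> \<delta>"
      by (auto simp: LIMSEQ_ignore_initial_segment intro: LIMSEQ_offset)
    have \<epsilon>_less_\<delta>: "\<epsilon> n < \<delta>" if "n \<ge> N" for n
    proof -
      have "\<epsilon> (Suc n) \<le> \<delta>"
      proof (rule tendsto_lowerbound[OF \<delta>])
        show "\<forall>\<^sub>F m in sequentially. \<epsilon> (Suc n) \<le> \<epsilon> m"
          using \<epsilon>_less[of "Suc n"] that
          by (intro eventually_mono[OF eventually_gt_at_top[of "Suc n"]]) (simp add: less_imp_le)
      qed simp
      then show ?thesis using \<epsilon>_Suc[OF that] by simp
    qed
    have below_\<delta>: "\<exists>n\<ge>N. e \<le> \<epsilon> n" if "e < \<delta>" for e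
      using eventually_happens[OF eventually_conj[OF order_tendstoD(1)[OF \<delta> that] eventually_ge_at_top[of N]]]
      by (auto intro: less_imp_le)
    \<comment> \<open>Strict inequalities become weak in the limit, so ties between terms at
      \<open>\<delta>\<close> are still possible.\<close>
    have affine_limit: "p + k * \<delta> \<le> p' + k' * \<delta>"
      if "\<And>n. n \<ge> N \<Longrightarrow> p + k * \<epsilon> n \<le> p' + k' * \<epsilon> n" for p p' k k' :: real
    proof (rule LIMSEQ_le)
      show "(\<lambda>n. p + k * \<epsilon> n) \<longlonglongrightarrow> p + k * \<delta>" "(\<lambda>n. p' + k' * \<epsilon> n) \<longlonglongrightarrow> p' + k' * \<delta>"
        by (intro tendsto_intros \<delta>)+
    qed (use that in blast)
    have weak_g: "val (b i) + i * \<delta> \<le> val (b k) + k * \<delta>" if "k \<in> S" for k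
    proof (rule affine_limit)
      fix n assume "n \<ge> N"
      from N(3)[OF this] show "val (b i) + i * \<epsilon> n \<le> val (b k) + k * \<epsilon> n"
        using that by (cases "k = i") (auto simp: dom_g_def intro: less_imp_le)
    qed
    have weak_h: "val (c j) + j * \<delta> \<le> val (c k) + k * \<delta>" if "k \<in> T" for k
    proof (rule affine_limit)
      fix n assume "n \<ge> N"
      from N(4)[OF this] show "val (c j) + j * \<epsilon> n \<le> val (c k) + k * \<epsilon> n"
        using that by (cases "k = j") (auto simp: dom_h_def intro: less_imp_le)
    qed
    have ineq_\<delta>: "ineq \<delta>"
      unfolding ineq_def by (rule affine_limit) (use ineq in \<open>simp add: ineq_def\<close>)
    \<comment> \<open>If a multiple of \<open>\<delta>\<close> is a value, then \<open>v (q x) \<le> \<delta>\<close> is a clopen condition, and the case of equality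
      needs the bound on v (h x), as h may have several dominant terms there. Otherwise the affine
      functions do not cross at \<open>\<delta>\<close>, so the dominant terms remain dominant slightly beyond \<open>\<delta>\<close>.\<close>
    show ?thesis
    proof (cases "\<exists>(m::nat) a. m > (0::nat) \<and> a \<noteq> 0 \<and> m * \<delta> = val a")
      case True
      then obtain m :: nat and a where a: "m > 0" "a \<noteq> 0" "m * \<delta> = val a"  by blast
      have q_nbhd: "clopen_nbhd s (\<lambda>x. m * val (poly q x) \<le> val a)"
      proof (rule clopen_nbhd_multiple_val_le[OF pc \<open>q \<noteq> 0\<close> a(2)],
          rule eventually_mono[OF eventually_ge_at_top[of N]])
        fix n assume "n \<ge> N"
        then show "m * val (poly q (s n)) \<le> val a"
          unfolding a(3)[symmetric] \<epsilon>_def[symmetric]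
          using \<epsilon>_less_\<delta> by (intro mult_left_mono) (auto intro: less_imp_le)
      qed
      \<comment> \<open>Since \<open>m * \<delta>\<close> is the value of \<open>a\<close>, this
        element realises \<open>m\<close> times the value of the \<open>j\<close>-th term of
        \<open>h\<close> at \<open>\<delta>\<close>.\<close>
      let ?d = "c j ^ m * a ^ j"
      have d: "?d \<noteq> 0" "val ?d = m * (val (c j) + j * \<delta>)"
        using a(1,2) h(4)[OF h(2)] by (simp_all add: val_mult val_power a(3)[symmetric] distrib_left)
      have h_nbhd: "clopen_nbhd s (\<lambda>x. m * val (poly h x) \<le> val ?d)"
      proof (rule clopen_nbhd_multiple_val_le[OF pc \<open>h \<noteq> 0\<close> d(1)],
          rule eventually_mono[OF eventually_ge_at_top[of N]])
        fix n assume n: "n \<ge> N"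
        have "val (poly h (s n)) = val (c j) + j * \<epsilon> n"
          using value_h[of "s n"] N(1,4)[OF n] by (simp add: val_def[of "poly h (s n)"] \<epsilon>_def)
        also have "\<dots> \<le> val (c j) + j * \<delta>"
          using \<epsilon>_less_\<delta>[OF n] by (simp add: mult_left_mono)
        finally show "m * val (poly h (s n)) \<le> val ?d"
          unfolding d by (rule mult_left_mono) simp
      qed
      show ?thesis
      proof (rule clopen_nbhd_mono[OF clopen_nbhd_conj[OF clopen_nbhd_conj[OF near_nbhd lower_nbhd]
              clopen_nbhd_conj[OF q_nbhd h_nbhd]]])
        fix x
        assume x: "(near x \<and> \<epsilon> N < val (poly q x)) \<and> m * val (poly q x) \<le> val a \<and>
          m * val (poly h x) \<le> val ?d"
        then have "val (poly q x) \<le> \<delta>" "val (poly h x) \<le> val (c j) + j * \<delta>"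
          using a(1) unfolding d(2) a(3)[symmetric] by simp_all
        show "v (poly h x) \<le> v (poly g x)"
        \<comment> \<open>At \<open>\<delta>\<close> the imposed bound on \<open>h\<close> meets the
          lower bound on \<open>g\<close>, which ties do not spoil; below \<open>\<delta>\<close>
          the lemma \<open>between\<close> applies.\<close>
        proof (cases "val (poly q x) = \<delta>")
          case True
          have "v (poly h x) \<le> ereal (val (c j) + j * \<delta>)"
            using \<open>val (poly h x) \<le> _\<close> x by (simp add: v_eq_val near_def)
          also have "\<dots> \<le> ereal (val (b i) + i * \<delta>)"
            using ineq_\<delta> by (simp add: ineq_def)
          also have "\<dots> \<le> v (poly g x)"
            using expansion_value(1)[OF g(3,1,2), where b = b and x = x and e = \<delta>]
              weak_g x True g(4) by (simp add: near_def)
          finally show ?thesis .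
        next
          case False
          then show ?thesis
            using below_\<delta>[of "val (poly q x)"] between[of x] x \<open>val (poly q x) \<le> \<delta>\<close> by fastforce
        qed
      qed
    next
      case False
      have no_crossing: "k = k'" if "a \<noteq> 0" "a' \<noteq> 0" "val a + k * \<delta> = val a' + k' * \<delta>"
        for a a' :: 'a and k k' :: nat
        using multiple_of_crossing[OF that(1,2) _ that(3)] False by blast
      have "dom_g \<delta>"
        unfolding dom_g_def
      proof
        fix k assume k: "k \<in> S - {i}"
        then have "val (b i) + i * \<delta> \<noteq> val (b k) + k * \<delta>"
          using no_crossing[OF g(4)[OF g(2)] g(4), of k] by auto
        then show "val (b i) + i * \<delta> < val (b k) + k * \<delta>"
          using weak_g[of k] k by auto
      qed
      have "dom_h \<delta>"
        unfolding dom_h_def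
      proof
        fix k assume k: "k \<in> T - {j}"
        then have "val (c j) + j * \<delta> \<noteq> val (c k) + k * \<delta>"
          using no_crossing[OF h(4)[OF h(2)] h(4), of k] by auto
        then show "val (c j) + j * \<delta> < val (c k) + k * \<delta>"
          using weak_h[of k] k by auto
      qed
      have affine_less: "\<forall>\<^sub>F e in nhds \<delta>. p + k * e < p' + k' * e"
        if "p + k * \<delta> < p' + k' * \<delta>" for p p' k k' :: real
      proof -
        have "((\<lambda>e. p' + k' * e - (p + k * e)) \<longlongrightarrow> p' + k' * \<delta> - (p + k * \<delta>)) (nhds \<delta>)"
          by (intro tendsto_intros filterlim_ident)
        then have "\<forall>\<^sub>F e in nhds \<delta>. 0 < p' + k' * e - (p + k * e)"
          using that by (intro order_tendstoD(1)) auto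
        then show ?thesis by simp
      qed
      have "\<forall>\<^sub>F e in nhds \<delta>. ineq e"
      \<comment> \<open>Equality at \<open>\<delta>\<close> forces equal slopes, so both affine
        functions coincide everywhere. A strict inequality persists near
        \<open>\<delta>\<close>.\<close>
      proof (cases "val (c j) + j * \<delta> = val (b i) + i * \<delta>")
        case True
        then have "j = i"
          by (rule no_crossing[OF h(4)[OF h(2)] g(4)[OF g(2)]])
        then show ?thesis using True by (simp add: ineq_def)
      next
        case False
        then have "val (c j) + j * \<delta> < val (b i) + i * \<delta>"
          using ineq_\<delta> by (simp add: ineq_def)
        from affine_less[OF this] show ?thesis
          unfolding ineq_def by (rule eventually_mono) simp
      qed
      moreover have "\<forall>\<^sub>F e in nhds \<delta>. dom_g e" "\<forall>\<^sub>F e in nhds \<delta>. dom_h e"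
        using \<open>dom_g \<delta>\<close> \<open>dom_h \<delta>\<close> g(1) h(1) affine_less
        unfolding dom_g_def dom_h_def by (simp_all add: eventually_ball_finite)
      ultimately have "\<forall>\<^sub>F e in nhds \<delta>. dom_g e \<and> dom_h e \<and> ineq e"
        by (simp add: eventually_conj)
      then obtain r where r: "r > 0" "\<And>e. dist e \<delta> < r \<Longrightarrow> dom_g e \<and> dom_h e \<and> ineq e"
        unfolding eventually_nhds_metric by blast
      obtain d where "d \<noteq> 0" "val d > 0"
        using exists_positive_val[OF pc] by blast
      \<comment> \<open>The threshold \<open>val a / m\<close> lies strictly between
        \<open>\<delta>\<close> and \<open>\<delta> + r\<close>: it admits all late terms of
        \<open>s\<close> and keeps \<open>x\<close> where the predicates hold.\<close>
      then obtain m :: nat and a where a: "m > 0" "a \<noteq> 0" "m * \<delta> < val a" "val a < m * (\<delta> + r)"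
        using rational_multiple_between[of d \<delta> "\<delta> + r"] r(1) by auto
      have q_nbhd: "clopen_nbhd s (\<lambda>x. m * val (poly q x) \<le> val a)"
      proof (rule clopen_nbhd_multiple_val_le[OF pc \<open>q \<noteq> 0\<close> a(2)],
          rule eventually_mono[OF eventually_ge_at_top[of N]])
        fix n assume "n \<ge> N"
        then have "m * \<epsilon> n \<le> m * \<delta>"
          using \<epsilon>_less_\<delta> by (intro mult_left_mono) (auto intro: less_imp_le)
        then show "m * val (poly q (s n)) \<le> val a"
          using a(3) by (simp add: \<epsilon>_def)
      qed
      show ?thesis
      proof (rule clopen_nbhd_mono[OF clopen_nbhd_conj[OF clopen_nbhd_conj[OF near_nbhd lower_nbhd] q_nbhd]])
        fix x
        assume x: "(near x \<and> \<epsilon> N < val (poly q x)) \<and> m * val (poly q x) \<le> val a"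
        show "v (poly h x) \<le> v (poly g x)"
        proof (cases "val (poly q x) < \<delta>")
          case True
          then show ?thesis
            using below_\<delta>[of "val (poly q x)"] between[of x] x by blast
        next
          case False
          have "m * val (poly q x) < m * (\<delta> + r)"
            using x a(4) by simp
          then have "val (poly q x) < \<delta> + r"
            using a(1) by simp
          then have "dist (val (poly q x)) \<delta> < r"
            using False by (simp add: dist_real_def)
          then show ?thesis
            using r(2) value_g[of x] value_h[of x] x by (simp add: ineq_def)
        qed
      qed
    qed
  qed
qed

text \<open>If all polynomials are stable, both values are locally constant and the comparison is
  inherited; otherwise a key polynomial exists. The right side is infinite for
  \<open>g = 0\<close>.\<close>

lemma clopen_nbhd_le_poly:
  assumes pc: "pseudo_convergent v s" and "h \<noteq> 0"
    and le: "\<forall>\<^sub>F n in sequentially. v (poly h (s n)) \<le> v (poly g (s n))"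
  shows "clopen_nbhd s (\<lambda>x. v (poly h x) \<le> v (poly g x))"
proof (cases "g = 0")
  case True
  then show ?thesis using pc by (auto intro: clopen_nbhd_eventually)
next
  case False
  show ?thesis
  proof (cases "\<forall>p. stable s p")
    case True
    obtain b where b: "\<forall>\<^sub>F n in sequentially. v (poly g (s n)) = v b"
      using stable_value[OF pc] True \<open>g \<noteq> 0\<close> by blast
    obtain c where c: "\<forall>\<^sub>F n in sequentially. v (poly h (s n)) = v c"
      using stable_value[OF pc] True \<open>h \<noteq> 0\<close> by blast
    have "\<forall>\<^sub>F n in sequentially. v c \<le> v b"
      using b c le by eventually_elim simp
    then have "v c \<le> v b" by simp
    have "clopen_nbhd s (\<lambda>x. v (poly h x) = v c \<and> v (poly g x) = v b)"
      using True b c by (intro clopen_nbhd_conj clopen_nbhd_stable_value pc) auto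
    then show ?thesis
      by (rule clopen_nbhd_mono) (use \<open>v c \<le> v b\<close> in simp)
  next
    case False
    then obtain q where "key_polynomial s q"
      using exists_key_polynomial by blast
    then show ?thesis
      using clopen_nbhd_le_key[OF pc _ \<open>g \<noteq> 0\<close> \<open>h \<noteq> 0\<close> le] by blast
  qed
qed

text \<open>A representation of \<open>\<phi>\<close> as a fraction turns membership into a
  comparison of values. The result is the hypothesis of the regularity criterion below.\<close>

lemma exists_clopen_subset_basic:
  assumes "U \<in> \<V>" "\<phi> \<in> U"
  shows "\<exists>D. openin X D \<and> closedin X D \<and> U \<in> D \<and> D \<subseteq> {U \<in> \<V>. \<phi> \<in> U}"
proof -
  obtain s where s: "pseudo_convergent v s" "U = \<D> s"
    using assms(1) unfolding V_space_def by blast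
  obtain g h where \<phi>: "\<phi> = Fraction_Field.Fract g h" "h \<noteq> 0"
    by (cases \<phi>)
  have "clopen_nbhd s (\<lambda>x. v (poly h x) \<le> v (poly g x))"
    using assms(2) s \<phi> by (intro clopen_nbhd_le_poly) (simp_all add: mem_V_dom_Fract)
  then obtain D where D: "openin X D" "closedin X D" "\<D> s \<in> D"
    "\<And>t. pseudo_convergent v t \<Longrightarrow> \<D> t \<in> D \<Longrightarrow>
      \<forall>\<^sub>F n in sequentially. v (poly h (t n)) \<le> v (poly g (t n))"
    unfolding clopen_nbhd_def by blast
  have "D \<subseteq> \<V>"
    using openin_subset[OF D(1)] by simp
  moreover have "\<phi> \<in> W" if W: "W \<in> D" for W
  proof -
    obtain t where t: "pseudo_convergent v t" "W = \<D> t"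
      using W \<open>D \<subseteq> \<V>\<close> unfolding V_space_def by blast
    then show ?thesis
      using D(4)[OF t(1)] W \<phi> by (simp add: mem_V_dom_Fract)
  qed
  ultimately show ?thesis
    using D s(2) by blast
qed

end

section \<open>Regularity from clopen neighbourhoods\<close>

text \<open>Containing a clopen neighbourhood of each point passes to finite intersections and to
  unions, hence to all open sets. Such a neighbourhood inside the complement of a closed set is
  separated from that set by its own complement.\<close>

lemma regular_space_clopen_subbasis:
  assumes "\<And>S x. S \<in> \<S> \<Longrightarrow> x \<in> S \<Longrightarrow> \<exists>D. openin (topology_generated_by \<S>) D \<and>
    closedin (topology_generated_by \<S>) D \<and> x \<in> D \<and> D \<subseteq> S"
  shows "regular_space (topology_generated_by \<S>)"
proof -
  let ?T = "topology_generated_by \<S>"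
  have base: "\<exists>D. openin ?T D \<and> closedin ?T D \<and> x \<in> D \<and> D \<subseteq> W"
    if "generate_topology_on \<S> W" "x \<in> W" for W x
    using that
  proof (induction arbitrary: x rule: generate_topology_on.induct)
    case (Int a b)
    obtain D where "openin ?T D" "closedin ?T D" "x \<in> D" "D \<subseteq> a"
      using Int.IH(1)[of x] Int.prems by blast
    moreover obtain E where "openin ?T E" "closedin ?T E" "x \<in> E" "E \<subseteq> b"
      using Int.IH(2)[of x] Int.prems by blast
    ultimately show ?case
      by (intro exI[of _ "D \<inter> E"]) auto
  next
    case (UN K)
    then obtain k where k: "k \<in> K" "x \<in> k" by blast
    from UN.IH[OF this] k(1) show ?case by blast
  qed (use assms in auto)
  show ?thesis
    unfolding regular_space_def
  proof (intro allI impI)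
    fix C x
    assume C: "closedin ?T C \<and> x \<in> topspace ?T - C"
    then have "generate_topology_on \<S> (topspace ?T - C)"
      by (simp add: closedin_def openin_topology_generated_by_iff)
    then obtain D where "openin ?T D" "closedin ?T D" "x \<in> D" "D \<subseteq> topspace ?T - C"
      using base C by blast
    moreover from this have "openin ?T (topspace ?T - D)" "C \<subseteq> topspace ?T - D"
      "disjnt D (topspace ?T - D)"
      using C closedin_subset[of ?T C] unfolding disjnt_def by blast+
    ultimately show "\<exists>U W. openin ?T U \<and> openin ?T W \<and> x \<in> U \<and> C \<subseteq> W \<and> disjnt U W"
      by blast
  qed
qed

theorem theorem6p15:
  fixes V :: "'a::field set" and v :: "'a \<Rightarrow> ereal"
  assumes "rank_one_valuation_domain V"
    and "real_valuation v" and "valuation_ring v = V"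
    and "W_space v \<noteq> {}"
  shows "regular_with_closed_points (zariski_topology (V_space V v))"
proof -
  interpret real_valued_field v
    using assms(2) by unfold_locales
  have "regular_space X"
    unfolding zariski_topology_def
  proof (rule regular_space_clopen_subbasis)
    fix S U
    assume "S \<in> range (\<lambda>\<phi>. {U \<in> \<V>. \<phi> \<in> U})" "U \<in> S"
    then obtain \<phi> where "S = {U \<in> \<V>. \<phi> \<in> U}" "U \<in> \<V>" "\<phi> \<in> U"
      by blast
    then show "\<exists>D. openin (topology_generated_by (range (\<lambda>\<phi>. {U \<in> \<V>. \<phi> \<in> U}))) D \<and>
        closedin (topology_generated_by (range (\<lambda>\<phi>. {U \<in> \<V>. \<phi> \<in> U}))) D \<and> U \<in> D \<and> D \<subseteq> S"
      using exists_clopen_subset_basic[of U \<phi>] unfolding zariski_topology_def by simp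
  qed
  \<comment> \<open>Distinct rings differ in some \<open>\<phi>\<close>, whose subbasic set contains
    exactly one of them. With regularity this gives Hausdorff, hence closed points.\<close>
  moreover have "t0_space X"
    unfolding t0_space_def
  proof (intro ballI impI)
    fix U W assume "U \<in> topspace X" "W \<in> topspace X" "U \<noteq> W"
    moreover from \<open>U \<noteq> W\<close> obtain \<phi> where "\<phi> \<in> U \<longleftrightarrow> \<phi> \<notin> W"
      by blast
    ultimately show "\<exists>S. openin X S \<and> (U \<notin> S \<longleftrightarrow> W \<in> S)"
      using openin_basic[of \<phi>] by (intro exI[of _ "{U \<in> \<V>. \<phi> \<in> U}"]) auto
  qed
  ultimately have "Hausdorff_space X"
    using regular_t0_eq_Hausdorff_space by blast
  then show ?thesis
    using \<open>regular_space X\<close> assms(3)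
    by (simp add: regular_with_closed_points_def closedin_Hausdorff_sing_eq)
qed

end
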